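(* (Progress) Let $\mathcal{D}$ be a set of process definitions and $\Theta$ a process definition typing context such that $\mathcal{D}$ can be typed according to $\Theta$ (using the restricted judgement $\vdash_{0}$). Let $\mathcal{A}$ be a sink-final, deadlock-free CSM satisfying feasible eventual reception and let $(\vec q,\xi)$ be a configuration of $\mathcal{A}$. If $\Theta\mid\Gamma^s_{\vec q}\mid\Delta^s_\xi\vdash_{\mathrm{SF}}R$ and $(\vec q,\xi)$ can take a step, then there exist some $R'$ and $(\vec q\,',\xi')$ such that $R\to R'$, $(\vec q,\xi)\to(\vec q\,',\xi')$, and $\Theta\mid\Gamma^s_{\vec q\,'}\mid\Delta^s_{\xi'}\vdash_{\mathrm{SF}}R'$.
   Context: **Communicating state machines (CSMs).** $\mathsf{snd}(p,q,m)$ is the event "$p$ sends message $m$ to $q$"; $\mathsf{rcv}(p,q,m)$ is "$q$ receives $m$ from $p$"; $\Sigma_p$ are the events performed by $p$; $\Sigma=\bigcup_p\Sigma_p$. A CSM $\mathcal{A}=\{A_p\}_{p\in\mathcal{P}_{\mathcal{A}}}$ has one finite state machine $A_p$ over $\Sigma_p$ per participant ($\varepsilon$-transitions allowed). It is sink-final if in every $A_p$ a state is final iff it has no outgoing transitions. A configuration $(\vec q,\xi)$ consists of a state $\vec q_p$ of each $A_p$ and a finite word $\xi(p,q)$ of messages for each ordered pair $p\ne q$; initially all states are initial and all channels empty. Steps $(\vec q,\xi)\to(\vec q\,',\xi')$: a transition $\mathsf{snd}(p,q,m)$ of $A_p$ appends $m$ to $\xi(p,q)$; a transition $\mathsf{rcv}(p,q,m)$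 of $A_q$ removes $m$ from the head of $\xi(p,q)$; $\varepsilon$-transitions only change the local state. $\mathrm{reach}(\mathcal{A})$ is the set of configurations reachable from the initial one. A configuration is final if all local states are final and all channels empty; $\mathcal{L}(\mathcal{A})$ is the set of traces of maximal runs (infinite, or ending in a final configuration). $\mathcal{A}$ is deadlock-free if every reachable configuration without outgoing transitions is final. In a word $w=w_1w_2\dots$, a send $w_i=\mathsf{snd}(p,q,m)$ is matched by $w_j=\mathsf{rcv}(p,q,m)$, $i<j$, if the message sequence of sends from $p$ to $q$ in $w_1\dots w_i$ equals the message sequence of receives by $q$ from $p$ in $w_1\dots w_j$. $\mathcal{A}$ satisfies feasible eventual reception if for every finite prefix $w$ of a word in $\mathcal{L}(\mathcal{A})$ and every unmatched send in $w$ there is an extension $w'\in\mathcal{L}(\mathcal{A})$ of $w$ in which that send is matched. **Conventions on CSMs used as protocols.** Messages are of the form $l(t)$ with $l$ a label from a finite set and $t$ a payload type; payload types are states of (the state machines of) CSMs, and $\mathbb{L}$ denotes the set of all such states (a message may also carry no payload; then all parts of the rules below concerning its payload are dropped). State sets of all state machines of all CSMs are pairwise disjoint, so $\delta(q)$ unambiguously denotes the set of pairs (event, target) of transitions leaving state $q$. Two transitions from the same state with same sender, receiver and label have the same payload type. There is a strict partial order $<$ on CSMs such that the messages of $\mathcal{A}$ use only states of CSMs $\mathcal{B}<\mathcal{A}$. $\mathrm{End}(q)$ holds iff $q$ is final and has no outgoing receive transition. **Syntax.** Session endpoints: $c::=x\mid s[p]$ ($x$ variable, $s$ session, $p$ participant).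 Processes: $P::=0\mid P_1\parallel P_2\mid(\nu s:\mathcal{A})P\mid\bigoplus_{i\in I}c[q_i]!l_i\langle c_i\rangle.P_i\mid\&_{i\in I}c[q_i]?l_i(y_i).P_i\mid Q[\vec c]$, with $I$ finite non-empty and $Q$ a process identifier. Runtime configurations: $R::=0\mid R_1\parallel R_2\mid(\nu s:\mathcal{A})R\mid\bigoplus_{i\in I}c[q_i]!l_i\langle c_i\rangle.P_i\mid\&_{i\in I}c[q_i]?l_i(y_i).P_i\mid Q[\vec c]\mid s\triangleright\sigma\mid\mathsf{err}$, where $\sigma$ maps each pair of participants to a finite word of messages $l\langle v\rangle$ ($v$ an endpoint $s'[p]$); $\sigma_\varepsilon$ is the map with all queues empty. $\mathcal{D}$ contains exactly one definition $Q[\vec x]=P$ for each identifier, where $P$ is an internal choice $\bigoplus$ or external choice $\&$; $\mathcal{D}(Q,\vec c)=P[\vec c/\vec x]$. $\lceil P_1\parallel P_2\rceil=\lceil P_1\rceil\parallel\lceil P_2\rceil$, $\lceil(\nu s:\mathcal{A})P\rceil=(\nu s:\mathcal{A})(\lceil P\rceil\parallel s\triangleright\sigma_\varepsilon)$, $\lceil P\rceil=P$ otherwise. Bound names are always distinct from free names. **Structural precongruence.** $\equiv$ is the congruence generated by commutativity and associativity of $\parallel$, $R\parallel0\equiv R$, $(\nu s:\mathcal{A})(\nu s':\mathcal{B})R\equiv(\nu s':\mathcal{B})(\nu s:\mathcal{A})R$, and $(\nu s:\mathcal{A})(R_1\parallel R_2)\equiv R_1\parallel(\nu s:\mathcal{A})R_2$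 if $s$ not free in $R_1$. $\sqsubseteq$ is the smallest precongruence on runtime configurations containing $\equiv$ and $(\nu s:\mathcal{A})\,s\triangleright\sigma_\varepsilon\sqsubseteq0$. **Reduction.** Contexts $E::=E\parallel R\mid R\parallel E\mid(\nu s:\mathcal{A})E\mid[\,]$. Rules: - if $\mathcal{D}(Q,\vec c)\parallel R\to R'$ then $Q[\vec c]\parallel R\to R'$; - if $R\to R'$ then $E[R]\to E[R']$; - for $k\in I$: $\bigoplus_{i\in I}s[p][q_i]!l_i\langle v_i\rangle.P_i\parallel s\triangleright\sigma[(p,q_k)\mapsto\vec m]\to\lceil P_k\rceil\parallel s\triangleright\sigma[(p,q_k)\mapsto\vec m\cdot l_k\langle v_k\rangle]$; - for $k\in I$: $\&_{i\in I}s[p][q_i]?l_i(y_i).P_i\parallel s\triangleright\sigma[(q_k,p)\mapsto l_k\langle v_k\rangle\cdot\vec m]\to\lceil P_k[v_k/y_k]\rceil\parallel s\triangleright\sigma[(q_k,p)\mapsto\vec m]$; - if $R_1\sqsubseteq R_1'$, $R_1'\to R_2'$, $R_2'\sqsubseteq R_2$ then $R_1\to R_2$; - if for every $i\in I$ the queue $\sigma(q_i,p)$ is non-empty and the label of its first message differs from $l_i$, then $\&_{i\in I}s[p][q_i]?l_i(y_i).P_i\parallel s\triangleright\sigma\to\mathsf{err}$; - if $\sigma(p,q)\neq\varepsilon$ for some $p,q$, then $(\nu s:\mathcal{A})\,s\triangleright\sigma\to\mathsf{err}$. **Typing contexts.** $\Theta$ maps process identifiers to tuples of types in $\mathbb{L}$.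 $\Gamma$ is a finite set of bindings $c:q$ ($q\in\mathbb{L}$), at most one per $c$. $\Delta$ is a finite set of bindings $s[p][q]:\tau$, at most one per $s[p][q]$, with $\tau$ a finite word of message types $l(t)$. Comma denotes disjoint union. $\Gamma^s_{\vec q}=\{s[p]:\vec q_p\}_{p\in\mathcal{P}_{\mathcal{A}}}$ and $\Delta^s_\xi=\{s[p][q]:\xi(p,q)\}_{p\neq q\in\mathcal{P}_{\mathcal{A}}}$. **Restriction-free typing of processes, $\Theta\mid\Gamma\vdash_0P$** ($p$ below is the participant whose machine contains state $q$; there is no rule for $(\nu s:\mathcal{A})P$): - $\Theta\mid\vec c:\vec L\vdash_0Q[\vec c]$ if $\Theta(Q)=\vec L$; - $\Theta\mid\emptyset\vdash_00$; - if $\Theta\mid\Gamma\vdash_0P$ and $\mathrm{End}(q)$ then $\Theta\mid c:q,\Gamma\vdash_0P$; - if $\Theta\mid\Gamma_1\vdash_0P_1$ and $\Theta\mid\Gamma_2\vdash_0P_2$ then $\Theta\mid\Gamma_1,\Gamma_2\vdash_0P_1\parallel P_2$; - if $\delta(q)\supseteq\{(\mathsf{snd}(p,q_i,l_i(L_i)),q_i')\mid i\in I\}$ and for all $i\in I$, $\Theta\mid\Gamma,c:q_i',\{c_j:L_j\}_{j\in I\setminus\{i\}}\vdash_0P_i$, then $\Theta\mid\Gamma,c:q,\{c_i:L_i\}_{i\in I}\vdash_0\bigoplus_{i\in I}c[q_i]!l_i\langle c_i\rangle.P_i$; - if $\delta(q)=\{(\mathsf{rcv}(q_i,p,l_i(L_i)),q_i')\mid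 i\in I\}$ and for all $i\in I$, $\Theta\mid\Gamma,c:q_i',y_i:L_i\vdash_0P_i$, then $\Theta\mid\Gamma,c:q\vdash_0\&_{i\in I}c[q_i]?l_i(y_i).P_i$. $\mathcal{D}$ can be typed according to $\Theta$ if for each definition $Q[\vec x]=P$ in $\mathcal{D}$, $\Theta\mid\vec x:\Theta(Q)\vdash_0P$. **Typing of queues, $\Theta\mid\Gamma\mid\Delta\vdash_0s\triangleright\sigma$:** $\Theta\mid\emptyset\mid\{s[p][q]:\varepsilon\}_{p\neq q}\vdash_0s\triangleright\sigma_\varepsilon$; if $\Theta\mid\Gamma\mid\Delta,s[p][q]:\tau\vdash_0s\triangleright\sigma[(p,q)\mapsto\vec m]$ then $\Theta\mid\Gamma,v:L\mid\Delta,s[p][q]:l(L)\cdot\tau\vdash_0s\triangleright\sigma[(p,q)\mapsto l\langle v\rangle\cdot\vec m]$; and if $\Theta\mid\Gamma\mid\Delta\vdash_0s\triangleright\sigma$ and $\mathrm{End}(q)$ then $\Theta\mid\Gamma,c:q\mid\Delta\vdash_0s\triangleright\sigma$. **Session-fidelity typing (one session $s$ following $\mathcal{A}$, each participant implemented by a distinct process).** $\Theta\mid\Gamma\mid\Delta^s_\xi\vdash_{\mathrm{SF}}R$ holds if $R$ is (up to $\equiv$) of the form $\bigl(\parallel_{p\in\mathcal{P}_{\mathcal{A}}}Q_p\bigr)\parallel s\triangleright\sigma$ with processes $Q_p$, and $\Gamma$ splits as $\Gamma^s_{\vec q},\{\Gamma_p\}_{p\in\mathcal{P}_{\mathcal{A}}},\Gamma'$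 such that: $(\vec q,\xi)\in\mathrm{reach}(\mathcal{A})$; every binding $c:q'$ in any $\Gamma_p$ satisfies $\mathrm{End}(q')$; $\Theta\mid\Gamma_p,s[p]:\vec q_p\vdash_0Q_p$ for every $p\in\mathcal{P}_{\mathcal{A}}$; and $\Theta\mid\Gamma'\mid\Delta^s_\xi\vdash_0s\triangleright\sigma$. (For $\Gamma=\Gamma^s_{\vec q}$ this means $\Gamma_p=\Gamma'=\emptyset$.) *)

theory Defs
  imports Main "HOL-Library.Infinite_Set" "HOL-Library.Disjoint_Sets"
begin

section \<open>Communicating state machines\<close>

text \<open>A message type \<open>l(t)\<close> is a pair of a label and an optional payload type (\<^term>\<open>None\<close>: no
  payload). Payload types are states of CSMs, so they have the same type \<open>'q\<close> as states.
  In both kinds of events the sender comes first: \<open>Rcv p r m\<close> is performed by \<open>r\<close>.\<close>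

type_synonym ('l, 'q) msg = "'l \<times> 'q option"

datatype ('p, 'l, 'q) event =
    Snd 'p 'p "('l, 'q) msg"
  | Rcv 'p 'p "('l, 'q) msg"

text \<open>The label \<^term>\<open>None\<close> of a transition stands for \<open>\<epsilon>\<close>.\<close>

record ('p, 'l, 'q) fsm =
  states :: "'q set"
  init :: 'q
  finals :: "'q set"
  trans :: "('q \<times> ('p, 'l, 'q) event option \<times> 'q) set"

record ('p, 'l, 'q) csm =
  parts :: "'p set"
  mach :: "'p \<Rightarrow> ('p, 'l, 'q) fsm"

definition alphabet :: "'p set \<Rightarrow> 'p \<Rightarrow> ('p, 'l, 'q) event set" where
  "alphabet Ps p =
    {Snd p r m | r m. r \<in> Ps \<and> r \<noteq> p} \<union> {Rcv r p m | r m. r \<in> Ps \<and> r \<noteq> p}"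

definition wf_fsm :: "('p, 'l, 'q) event set \<Rightarrow> ('p, 'l, 'q) fsm \<Rightarrow> bool" where
  "wf_fsm \<Sigma> M \<longleftrightarrow>
    finite (states M) \<and> init M \<in> states M \<and> finals M \<subseteq> states M \<and> finite (trans M) \<and>
    trans M \<subseteq> states M \<times> ({None} \<union> Some ` \<Sigma>) \<times> states M"

definition wf_csm :: "('p, 'l, 'q) csm \<Rightarrow> bool" where
  "wf_csm A \<longleftrightarrow>
    finite (parts A) \<and> (\<forall>p\<in>parts A. wf_fsm (alphabet (parts A) p) (mach A p))"

definition sink_final :: "('p, 'l, 'q) csm \<Rightarrow> bool" where
  "sink_final A \<longleftrightarrow>
    (\<forall>p\<in>parts A. \<forall>q\<in>states (mach A p).
       q \<in> finals (mach A p) \<longleftrightarrow> \<not> (\<exists>e q'. (q, e, q') \<in> trans (mach A p)))"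

text \<open>Configurations are pairs of total functions. To keep them determined by their restrictions to
  the participants of the CSM, they take default values elsewhere.\<close>

type_synonym ('p, 'l, 'q) config = "('p \<Rightarrow> 'q) \<times> ('p \<Rightarrow> 'p \<Rightarrow> ('l, 'q) msg list)"

definition configs :: "('p, 'l, 'q) csm \<Rightarrow> ('p, 'l, 'q) config set" where
  "configs A =
    {(q, \<xi>). (\<forall>p\<in>parts A. q p \<in> states (mach A p)) \<and> (\<forall>p. p \<notin> parts A \<longrightarrow> q p = undefined) \<and>
       (\<forall>p r. \<not> (p \<in> parts A \<and> r \<in> parts A \<and> p \<noteq> r) \<longrightarrow> \<xi> p r = [])}"

definition init_config :: "('p, 'l, 'q) csm \<Rightarrow> ('p, 'l, 'q) config" where
  "init_config A = (\<lambda>p. if p \<in> parts A then init (mach A p) else undefined, \<lambda>p r. [])"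

definition final_config :: "('p, 'l, 'q) csm \<Rightarrow> ('p, 'l, 'q) config \<Rightarrow> bool" where
  "final_config A c \<longleftrightarrow>
    (\<forall>p\<in>parts A. fst c p \<in> finals (mach A p)) \<and>
    (\<forall>p\<in>parts A. \<forall>r\<in>parts A. p \<noteq> r \<longrightarrow> snd c p r = [])"

definition chan_upd :: "('p \<Rightarrow> 'p \<Rightarrow> 'a) \<Rightarrow> 'p \<Rightarrow> 'p \<Rightarrow> 'a \<Rightarrow> 'p \<Rightarrow> 'p \<Rightarrow> 'a" where
  "chan_upd f p r w = f(p := (f p)(r := w))"

inductive lstep ::
  "('p, 'l, 'q) csm \<Rightarrow> ('p, 'l, 'q) config \<Rightarrow> ('p, 'l, 'q) event option \<Rightarrow> ('p, 'l, 'q) config \<Rightarrow> bool"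
  for A where
  snd: "\<lbrakk>p \<in> parts A; (q p, Some (Snd p r m), q') \<in> trans (mach A p)\<rbrakk> \<Longrightarrow>
    lstep A (q, \<xi>) (Some (Snd p r m)) (q(p := q'), chan_upd \<xi> p r (\<xi> p r @ [m]))"
| rcv: "\<lbrakk>r \<in> parts A; (q r, Some (Rcv p r m), q') \<in> trans (mach A r); \<xi> p r = m # w\<rbrakk> \<Longrightarrow>
    lstep A (q, \<xi>) (Some (Rcv p r m)) (q(r := q'), chan_upd \<xi> p r w)"
| eps: "\<lbrakk>p \<in> parts A; (q p, None, q') \<in> trans (mach A p)\<rbrakk> \<Longrightarrow>
    lstep A (q, \<xi>) None (q(p := q'), \<xi>)"

definition cstep :: "('p, 'l, 'q) csm \<Rightarrow> ('p, 'l, 'q) config \<Rightarrow> ('p, 'l, 'q) config \<Rightarrow> bool" where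
  "cstep A c c' \<longleftrightarrow> (\<exists>e. lstep A c e c')"

inductive exec ::
  "('p, 'l, 'q) csm \<Rightarrow> ('p, 'l, 'q) config \<Rightarrow> ('p, 'l, 'q) event option list \<Rightarrow>
   ('p, 'l, 'q) config \<Rightarrow> bool"
  for A where
  "exec A c [] c"
| "\<lbrakk>exec A c es c'; lstep A c' e c''\<rbrakk> \<Longrightarrow> exec A c (es @ [e]) c''"

definition reach :: "('p, 'l, 'q) csm \<Rightarrow> ('p, 'l, 'q) config set" where
  "reach A = {c. \<exists>es. exec A (init_config A) es c}"

definition deadlock_free :: "('p, 'l, 'q) csm \<Rightarrow> bool" where
  "deadlock_free A \<longleftrightarrow> (\<forall>c\<in>reach A. (\<nexists>c'. cstep A c c') \<longrightarrow> final_config A c)"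

subsection \<open>Language and feasible eventual reception\<close>

datatype 'e word = Fin "'e list" | Inf "nat \<Rightarrow> 'e"

fun wtake :: "nat \<Rightarrow> 'e word \<Rightarrow> 'e list" where
  "wtake n (Fin u) = take n u"
| "wtake n (Inf f) = map f [0..<n]"

definition wprefix :: "'e list \<Rightarrow> 'e word \<Rightarrow> bool" where
  "wprefix u w \<longleftrightarrow> wtake (length u) w = u"

definition fin_trace :: "'e option list \<Rightarrow> 'e word" where
  "fin_trace es = Fin (map the (filter (\<lambda>e. e \<noteq> None) es))"

text \<open>An infinite run that ends in \<open>\<epsilon>\<close>-transitions only has a finite trace.\<close>

definition inf_trace :: "(nat \<Rightarrow> 'e option) \<Rightarrow> 'e word" where
  "inf_trace a =
    (let N = {n. a n \<noteq> None} in
     if infinite N then Inf (\<lambda>n. the (a (enumerate N n)))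
     else Fin (map (\<lambda>n. the (a n)) (sorted_list_of_set N)))"

definition lang :: "('p, 'l, 'q) csm \<Rightarrow> ('p, 'l, 'q) event word set" where
  "lang A =
    {fin_trace es | es. \<exists>c. exec A (init_config A) es c \<and> final_config A c} \<union>
    {inf_trace a | a. \<exists>cs. cs 0 = init_config A \<and> (\<forall>n. lstep A (cs n) (a n) (cs (Suc n)))}"

definition sent :: "'p \<Rightarrow> 'p \<Rightarrow> ('p, 'l, 'q) event list \<Rightarrow> ('l, 'q) msg list" where
  "sent p r w = concat (map (\<lambda>e. case e of
     Snd p' r' m \<Rightarrow> if p' = p \<and> r' = r then [m] else [] | Rcv p' r' m \<Rightarrow> []) w)"

definition received :: "'p \<Rightarrow> 'p \<Rightarrow> ('p, 'l, 'q) event list \<Rightarrow> ('l, 'q) msg list" where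
  "received p r w = concat (map (\<lambda>e. case e of
     Rcv p' r' m \<Rightarrow> if p' = p \<and> r' = r then [m] else [] | Snd p' r' m \<Rightarrow> []) w)"

text \<open>Positions are counted from 0; \<open>u\<close> is the prefix of \<open>w\<close> up to and including position \<open>j\<close>.\<close>

definition matched_by :: "('p, 'l, 'q) event word \<Rightarrow> nat \<Rightarrow> nat \<Rightarrow> bool" where
  "matched_by w i j \<longleftrightarrow> i < j \<and>
    (\<exists>u p r m. wprefix u w \<and> length u = Suc j \<and> u ! i = Snd p r m \<and> u ! j = Rcv p r m \<and>
       sent p r (take (Suc i) u) = received p r u)"

definition feasible_eventual_reception :: "('p, 'l, 'q) csm \<Rightarrow> bool" where
  "feasible_eventual_reception A \<longleftrightarrow>
    (\<forall>w i p r m. (\<exists>w0\<in>lang A. wprefix w w0) \<and> i < length w \<and> w ! i = Snd p r m \<and>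
        (\<nexists>j. matched_by (Fin w) i j) \<longrightarrow>
      (\<exists>w'\<in>lang A. wprefix w w' \<and> (\<exists>j. matched_by w' i j)))"

subsection \<open>Families of CSMs used as protocols\<close>

definition csm_states :: "('p, 'l, 'q) csm \<Rightarrow> 'q set" where
  "csm_states A = (\<Union>p\<in>parts A. states (mach A p))"

definition payload_states :: "('p, 'l, 'q) csm \<Rightarrow> 'q set" where
  "payload_states A = {t. \<exists>p\<in>parts A. \<exists>q q' r r' l.
     (q, Some (Snd r r' (l, Some t)), q') \<in> trans (mach A p) \<or>
     (q, Some (Rcv r r' (l, Some t)), q') \<in> trans (mach A p)}"

definition payload_det :: "('p, 'l, 'q) fsm \<Rightarrow> bool" where
  "payload_det M \<longleftrightarrow> (\<forall>q r r' l t t' q1 q2.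
     ((q, Some (Snd r r' (l, t)), q1) \<in> trans M \<and> (q, Some (Snd r r' (l, t')), q2) \<in> trans M \<longrightarrow>
        t = t') \<and>
     ((q, Some (Rcv r r' (l, t)), q1) \<in> trans M \<and> (q, Some (Rcv r r' (l, t')), q2) \<in> trans M \<longrightarrow>
        t = t'))"

text \<open>The set \<open>\<U>\<close> collects all CSMs under consideration; the assumptions below make
  \<open>\<delta>\<close>, \<open>End\<close> and the participant owning a state unambiguous.\<close>

definition csm_universe :: "('p, 'l, 'q) csm set \<Rightarrow> bool" where
  "csm_universe \<U> \<longleftrightarrow>
    (\<forall>A\<in>\<U>. wf_csm A \<and> (\<forall>p\<in>parts A. payload_det (mach A p))) \<and>
    (\<forall>A\<in>\<U>. \<forall>B\<in>\<U>. \<forall>p\<in>parts A. \<forall>r\<in>parts B.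
       (A, p) \<noteq> (B, r) \<longrightarrow> states (mach A p) \<inter> states (mach B r) = {}) \<and>
    (\<exists>lt. irreflp_on \<U> lt \<and> transp_on \<U> lt \<and>
       (\<forall>A\<in>\<U>. payload_states A \<subseteq> (\<Union>B\<in>{B\<in>\<U>. lt B A}. csm_states B)))"

definition all_states :: "('p, 'l, 'q) csm set \<Rightarrow> 'q set" where
  "all_states \<U> = (\<Union>A\<in>\<U>. csm_states A)"

definition owner :: "('p, 'l, 'q) csm set \<Rightarrow> 'q \<Rightarrow> 'p \<Rightarrow> bool" where
  "owner \<U> q p \<longleftrightarrow> (\<exists>A\<in>\<U>. p \<in> parts A \<and> q \<in> states (mach A p))"

definition delta :: "('p, 'l, 'q) csm set \<Rightarrow> 'q \<Rightarrow> (('p, 'l, 'q) event option \<times> 'q) set" where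
  "delta \<U> q = {(e, q'). \<exists>A\<in>\<U>. \<exists>p\<in>parts A. (q, e, q') \<in> trans (mach A p)}"

definition End :: "('p, 'l, 'q) csm set \<Rightarrow> 'q \<Rightarrow> bool" where
  "End \<U> q \<longleftrightarrow>
    (\<exists>A\<in>\<U>. \<exists>p\<in>parts A. q \<in> finals (mach A p)) \<and>
    (\<nexists>r r' m q'. (Some (Rcv r r' m), q') \<in> delta \<U> q)"

section \<open>Processes and runtime configurations\<close>

datatype (ep_vars: 'x, ep_sess: 's, 'p) endpoint = Var 'x | EP 's 'p

type_synonym ('p, 'l, 's) queues = "'p \<Rightarrow> 'p \<Rightarrow> ('l \<times> ('s \<times> 'p) option) list"

text \<open>One datatype of terms covers both syntactic categories; the predicates \<open>is_proc\<close> and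
  \<open>is_rt\<close> below carve out processes and runtime configurations. A family of branches indexed by
  \<open>I\<close> is a list indexed by its positions; a branch consists of the communication
  partner, the label, the payload (if any) and the continuation.
  \<open>vars\<close> and \<open>sess\<close> collect all variables and sessions, free or bound.\<close>

datatype ('p, 'l, 'q, vars: 'x, sess: 's, 'i) trm =
    Zero
  | Par "('p, 'l, 'q, 'x, 's, 'i) trm" "('p, 'l, 'q, 'x, 's, 'i) trm"
  | Res 's "('p, 'l, 'q) csm" "('p, 'l, 'q, 'x, 's, 'i) trm"
  | Send "('x, 's, 'p) endpoint"
      "('p \<times> 'l \<times> ('x, 's, 'p) endpoint option \<times> ('p, 'l, 'q, 'x, 's, 'i) trm) list"
  | Recv "('x, 's, 'p) endpoint"
      "('p \<times> 'l \<times> 'x option \<times> ('p, 'l, 'q, 'x, 's, 'i) trm) list"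
  | Call 'i "('x, 's, 'p) endpoint list"
  | Queue 's "('p, 'l, 's) queues"
  | Err

abbreviation empty_queues :: "('p, 'l, 's) queues" where
  "empty_queues \<equiv> \<lambda>p r. []"

inductive is_proc :: "('p, 'l, 'q, 'x, 's, 'i) trm \<Rightarrow> bool" where
  "is_proc Zero"
| "\<lbrakk>is_proc P1; is_proc P2\<rbrakk> \<Longrightarrow> is_proc (Par P1 P2)"
| "is_proc P \<Longrightarrow> is_proc (Res s A P)"
| "\<lbrakk>bs \<noteq> []; \<forall>(r, l, v, P)\<in>set bs. is_proc P\<rbrakk> \<Longrightarrow> is_proc (Send c bs)"
| "\<lbrakk>bs \<noteq> []; \<forall>(r, l, y, P)\<in>set bs. is_proc P\<rbrakk> \<Longrightarrow> is_proc (Recv c bs)"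
| "is_proc (Call i cs)"

fun is_rt :: "('p, 'l, 'q, 'x, 's, 'i) trm \<Rightarrow> bool" where
  "is_rt (Par R1 R2) \<longleftrightarrow> is_rt R1 \<and> is_rt R2"
| "is_rt (Res s A R) \<longleftrightarrow> is_rt R"
| "is_rt (Queue s \<sigma>) \<longleftrightarrow> True"
| "is_rt Err \<longleftrightarrow> True"
| "is_rt P \<longleftrightarrow> is_proc P"

fun bound_vars :: "('p, 'l, 'q, 'x, 's, 'i) trm \<Rightarrow> 'x set" where
  "bound_vars (Par R1 R2) = bound_vars R1 \<union> bound_vars R2"
| "bound_vars (Res s A R) = bound_vars R"
| "bound_vars (Send c bs) = (\<Union>(r, l, v, P)\<in>set bs. bound_vars P)"
| "bound_vars (Recv c bs) = (\<Union>(r, l, y, P)\<in>set bs. set_option y \<union> bound_vars P)"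
| "bound_vars R = {}"

fun bound_sess :: "('p, 'l, 'q, 'x, 's, 'i) trm \<Rightarrow> 's set" where
  "bound_sess (Par R1 R2) = bound_sess R1 \<union> bound_sess R2"
| "bound_sess (Res s A R) = insert s (bound_sess R)"
| "bound_sess (Send c bs) = (\<Union>(r, l, v, P)\<in>set bs. bound_sess P)"
| "bound_sess (Recv c bs) = (\<Union>(r, l, y, P)\<in>set bs. bound_sess P)"
| "bound_sess R = {}"

fun free_sess :: "('p, 'l, 'q, 'x, 's, 'i) trm \<Rightarrow> 's set" where
  "free_sess (Par R1 R2) = free_sess R1 \<union> free_sess R2"
| "free_sess (Res s A R) = free_sess R - {s}"
| "free_sess (Send c bs) =
    ep_sess c \<union> (\<Union>(r, l, v, P)\<in>set bs. (\<Union>d\<in>set_option v. ep_sess d) \<union> free_sess P)"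
| "free_sess (Recv c bs) = ep_sess c \<union> (\<Union>(r, l, y, P)\<in>set bs. free_sess P)"
| "free_sess (Call i cs) = (\<Union>c\<in>set cs. ep_sess c)"
| "free_sess (Queue s \<sigma>) = insert s {s'. \<exists>p r l p'. (l, Some (s', p')) \<in> set (\<sigma> p r)}"
| "free_sess R = {}"

text \<open>Simultaneous substitution of endpoints for free variables. It does not rename binders; see
  \<open>inst\<close> for the capture-avoiding version.\<close>

fun ep_subst :: "('x \<Rightarrow> ('x, 's, 'p) endpoint) \<Rightarrow> ('x, 's, 'p) endpoint \<Rightarrow> ('x, 's, 'p) endpoint" where
  "ep_subst f (Var x) = f x"
| "ep_subst f (EP s p) = EP s p"

fun subst ::
  "('x \<Rightarrow> ('x, 's, 'p) endpoint) \<Rightarrow> ('p, 'l, 'q, 'x, 's, 'i) trm \<Rightarrow> ('p, 'l, 'q, 'x, 's, 'i) trm" where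
  "subst f (Par R1 R2) = Par (subst f R1) (subst f R2)"
| "subst f (Res s A R) = Res s A (subst f R)"
| "subst f (Send c bs) =
    Send (ep_subst f c) (map (\<lambda>(r, l, v, P). (r, l, map_option (ep_subst f) v, subst f P)) bs)"
| "subst f (Recv c bs) =
    Recv (ep_subst f c)
      (map (\<lambda>(r, l, y, P). (r, l, y, subst (\<lambda>x. if y = Some x then Var x else f x) P)) bs)"
| "subst f (Call i cs) = Call i (map (ep_subst f) cs)"
| "subst f R = R"

text \<open>Renaming of the free occurrences of session \<open>s\<close> to \<open>s'\<close>.\<close>

fun sess_ren :: "'s \<Rightarrow> 's \<Rightarrow> ('p, 'l, 'q, 'x, 's, 'i) trm \<Rightarrow> ('p, 'l, 'q, 'x, 's, 'i) trm" where
  "sess_ren s s' (Par R1 R2) = Par (sess_ren s s' R1) (sess_ren s s' R2)"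
| "sess_ren s s' (Res t A R) = Res t A (if t = s then R else sess_ren s s' R)"
| "sess_ren s s' (Send c bs) =
    Send (map_endpoint id (id(s := s')) id c)
      (map (\<lambda>(r, l, v, P).
         (r, l, map_option (map_endpoint id (id(s := s')) id) v, sess_ren s s' P)) bs)"
| "sess_ren s s' (Recv c bs) =
    Recv (map_endpoint id (id(s := s')) id c)
      (map (\<lambda>(r, l, y, P). (r, l, y, sess_ren s s' P)) bs)"
| "sess_ren s s' (Call i cs) = Call i (map (map_endpoint id (id(s := s')) id) cs)"
| "sess_ren s s' (Queue t \<sigma>) =
    Queue ((id(s := s')) t)
      (\<lambda>p r. map (\<lambda>(l, v). (l, map_option (\<lambda>(u, p'). ((id(s := s')) u, p')) v)) (\<sigma> p r))"
| "sess_ren s s' R = R"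

subsection \<open>Structural (pre)congruence\<close>

text \<open>The least precongruence containing \<open>B\<close>.\<close>

inductive precong ::
  "(('p, 'l, 'q, 'x, 's, 'i) trm \<Rightarrow> ('p, 'l, 'q, 'x, 's, 'i) trm \<Rightarrow> bool) \<Rightarrow>
   ('p, 'l, 'q, 'x, 's, 'i) trm \<Rightarrow> ('p, 'l, 'q, 'x, 's, 'i) trm \<Rightarrow> bool"
  for B where
  base: "B R R' \<Longrightarrow> precong B R R'"
| refl: "precong B R R"
| trans: "\<lbrakk>precong B R1 R2; precong B R2 R3\<rbrakk> \<Longrightarrow> precong B R1 R3"
| par: "\<lbrakk>precong B R1 R1'; precong B R2 R2'\<rbrakk> \<Longrightarrow> precong B (Par R1 R2) (Par R1' R2')"
| res: "precong B R R' \<Longrightarrow> precong B (Res s A R) (Res s A R')"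
| send: "precong B P P' \<Longrightarrow>
    precong B (Send c (bs1 @ (r, l, v, P) # bs2)) (Send c (bs1 @ (r, l, v, P') # bs2))"
| recv: "precong B P P' \<Longrightarrow>
    precong B (Recv c (bs1 @ (r, l, y, P) # bs2)) (Recv c (bs1 @ (r, l, y, P') # bs2))"

text \<open>The convention that bound names differ from free names presupposes that bound names can be
  renamed. Terms being raw syntax here, \<open>\<alpha>\<close>-conversion is made explicit, as part of \<open>\<equiv>\<close>.\<close>

inductive alpha_ax ::
  "('p, 'l, 'q, 'x, 's, 'i) trm \<Rightarrow> ('p, 'l, 'q, 'x, 's, 'i) trm \<Rightarrow> bool" where
  "s' \<notin> sess R \<Longrightarrow> alpha_ax (Res s A R) (Res s' A (sess_ren s s' R))"
| "y' \<notin> vars P \<Longrightarrow>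
    alpha_ax (Recv c (bs1 @ (r, l, Some y, P) # bs2))
      (Recv c (bs1 @ (r, l, Some y', subst (Var(y := Var y')) P) # bs2))"

definition alpha ::
  "('p, 'l, 'q, 'x, 's, 'i) trm \<Rightarrow> ('p, 'l, 'q, 'x, 's, 'i) trm \<Rightarrow> bool" where
  "alpha = precong (symclp alpha_ax)"

inductive scong_ax ::
  "('p, 'l, 'q, 'x, 's, 'i) trm \<Rightarrow> ('p, 'l, 'q, 'x, 's, 'i) trm \<Rightarrow> bool" where
  alpha: "alpha_ax R R' \<Longrightarrow> scong_ax R R'"
| comm: "scong_ax (Par R1 R2) (Par R2 R1)"
| assoc: "scong_ax (Par (Par R1 R2) R3) (Par R1 (Par R2 R3))"
| zero: "scong_ax (Par R Zero) R"
| swap: "s \<noteq> s' \<Longrightarrow> scong_ax (Res s A (Res s' B R)) (Res s' B (Res s A R))"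
| extr: "s \<notin> free_sess R1 \<Longrightarrow> scong_ax (Res s A (Par R1 R2)) (Par R1 (Res s A R2))"

definition scong ::
  "('p, 'l, 'q, 'x, 's, 'i) trm \<Rightarrow> ('p, 'l, 'q, 'x, 's, 'i) trm \<Rightarrow> bool" where
  "scong = precong (symclp scong_ax)"

inductive sprec_ax ::
  "('p, 'l, 'q, 'x, 's, 'i) trm \<Rightarrow> ('p, 'l, 'q, 'x, 's, 'i) trm \<Rightarrow> bool" where
  cong: "scong R R' \<Longrightarrow> sprec_ax R R'"
| gc: "sprec_ax (Res s A (Queue s empty_queues)) Zero"

definition sprec ::
  "('p, 'l, 'q, 'x, 's, 'i) trm \<Rightarrow> ('p, 'l, 'q, 'x, 's, 'i) trm \<Rightarrow> bool" where
  "sprec = precong sprec_ax"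

subsection \<open>Reduction\<close>

text \<open>\<open>inst xs cs P P'\<close> states that \<open>P'\<close> is (an \<open>\<alpha>\<close>-variant of) \<open>P[cs/xs]\<close>: bound names of \<open>P\<close>
  are first made distinct from the names in \<open>cs\<close>.\<close>

definition inst ::
  "'x list \<Rightarrow> ('x, 's, 'p) endpoint list \<Rightarrow>
   ('p, 'l, 'q, 'x, 's, 'i) trm \<Rightarrow> ('p, 'l, 'q, 'x, 's, 'i) trm \<Rightarrow> bool" where
  "inst xs cs P P' \<longleftrightarrow> length xs = length cs \<and>
    (\<exists>P0. alpha P P0 \<and>
       (\<forall>c\<in>set cs. ep_vars c \<inter> bound_vars P0 = {} \<and> ep_sess c \<inter> bound_sess P0 = {}) \<and>
       P' = subst (\<lambda>x. case map_of (zip xs cs) x of Some c \<Rightarrow> c | None \<Rightarrow> Var x) P0)"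

text \<open>One definition \<open>Q[xs] = P\<close> for each process identifier \<open>Q\<close>.\<close>

type_synonym ('p, 'l, 'q, 'x, 's, 'i) defs = "'i \<Rightarrow> 'x list \<times> ('p, 'l, 'q, 'x, 's, 'i) trm"

definition wf_defs :: "('p, 'l, 'q, 'x, 's, 'i) defs \<Rightarrow> bool" where
  "wf_defs D \<longleftrightarrow>
    (\<forall>i xs P. D i = (xs, P) \<longrightarrow>
       distinct xs \<and> is_proc P \<and> ((\<exists>c bs. P = Send c bs) \<or> (\<exists>c bs. P = Recv c bs)))"

fun ceil :: "('p, 'l, 'q, 'x, 's, 'i) trm \<Rightarrow> ('p, 'l, 'q, 'x, 's, 'i) trm" where
  "ceil (Par P1 P2) = Par (ceil P1) (ceil P2)"
| "ceil (Res s A P) = Res s A (Par (ceil P) (Queue s empty_queues))"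
| "ceil P = P"

datatype ('p, 'l, 'q, 'x, 's, 'i) ectx =
    Hole
  | ParL "('p, 'l, 'q, 'x, 's, 'i) ectx" "('p, 'l, 'q, 'x, 's, 'i) trm"
  | ParR "('p, 'l, 'q, 'x, 's, 'i) trm" "('p, 'l, 'q, 'x, 's, 'i) ectx"
  | ResC 's "('p, 'l, 'q) csm" "('p, 'l, 'q, 'x, 's, 'i) ectx"

primrec plug ::
  "('p, 'l, 'q, 'x, 's, 'i) ectx \<Rightarrow> ('p, 'l, 'q, 'x, 's, 'i) trm \<Rightarrow> ('p, 'l, 'q, 'x, 's, 'i) trm" where
  "plug Hole R = R"
| "plug (ParL E R') R = Par (plug E R) R'"
| "plug (ParR R' E) R = Par R' (plug E R)"
| "plug (ResC s A E) R = Res s A (plug E R)"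

text \<open>Payloads must be values \<open>s[p]\<close> to be sent: a value is an endpoint of the form \<open>val_ep v\<close>.\<close>

definition val_ep :: "'s \<times> 'p \<Rightarrow> ('x, 's, 'p) endpoint" where
  "val_ep v = EP (fst v) (snd v)"

inductive red ::
  "('p, 'l, 'q, 'x, 's, 'i) defs \<Rightarrow>
   ('p, 'l, 'q, 'x, 's, 'i) trm \<Rightarrow> ('p, 'l, 'q, 'x, 's, 'i) trm \<Rightarrow> bool"
  for D where
  call: "\<lbrakk>D i = (xs, P); inst xs cs P P'; red D (Par P' R) R'\<rbrakk> \<Longrightarrow> red D (Par (Call i cs) R) R'"
| ctx: "red D R R' \<Longrightarrow> red D (plug E R) (plug E R')"
| send: "\<lbrakk>\<forall>(r, l, v, P)\<in>set bs. v \<in> range (map_option val_ep);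
      k < length bs; bs ! k = (r, l, map_option val_ep v, P)\<rbrakk> \<Longrightarrow>
    red D (Par (Send (EP s p) bs) (Queue s \<sigma>))
      (Par (ceil P) (Queue s (chan_upd \<sigma> p r (\<sigma> p r @ [(l, v)]))))"
| recv: "\<lbrakk>k < length bs; bs ! k = (r, l, Some y, P); \<sigma> r p = (l, Some v) # w;
      inst [y] [val_ep v] P P'\<rbrakk> \<Longrightarrow>
    red D (Par (Recv (EP s p) bs) (Queue s \<sigma>)) (Par (ceil P') (Queue s (chan_upd \<sigma> r p w)))"
| recv_no_payload: "\<lbrakk>k < length bs; bs ! k = (r, l, None, P); \<sigma> r p = (l, None) # w\<rbrakk> \<Longrightarrow>
    red D (Par (Recv (EP s p) bs) (Queue s \<sigma>)) (Par (ceil P) (Queue s (chan_upd \<sigma> r p w)))"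
| struct: "\<lbrakk>sprec R1 R1'; red D R1' R2'; sprec R2' R2\<rbrakk> \<Longrightarrow> red D R1 R2"
| err_label: "\<lbrakk>bs \<noteq> []; \<forall>(r, l, y, P)\<in>set bs. \<exists>l' v w. \<sigma> r p = (l', v) # w \<and> l' \<noteq> l\<rbrakk> \<Longrightarrow>
    red D (Par (Recv (EP s p) bs) (Queue s \<sigma>)) Err"
| err_orphan: "\<sigma> p r \<noteq> [] \<Longrightarrow> red D (Res s A (Queue s \<sigma>)) Err"

section \<open>Typing\<close>

text \<open>Typing contexts are partial maps, so that there is at most one binding per key. \<open>ctx_Union I F\<close>
  is the union of a family of contexts with disjoint domains.\<close>

type_synonym ('x, 's, 'p, 'q) gctx = "('x, 's, 'p) endpoint \<rightharpoonup> 'q"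
type_synonym ('s, 'p, 'l, 'q) dctx = "('s \<times> 'p \<times> 'p) \<rightharpoonup> ('l, 'q) msg list"

definition ctx_disjoint :: "'j set \<Rightarrow> ('j \<Rightarrow> ('c \<rightharpoonup> 'q)) \<Rightarrow> bool" where
  "ctx_disjoint I F \<longleftrightarrow> disjoint_family_on (\<lambda>i. dom (F i)) I"

definition ctx_Union :: "'j set \<Rightarrow> ('j \<Rightarrow> ('c \<rightharpoonup> 'q)) \<Rightarrow> ('c \<rightharpoonup> 'q)" where
  "ctx_Union I F =
    (\<lambda>c. if \<exists>i\<in>I. c \<in> dom (F i) then F (THE i. i \<in> I \<and> c \<in> dom (F i)) c else None)"

text \<open>The payload binding \<open>c : L\<close>, absent if there is no payload.\<close>

definition pbind :: "'c option \<Rightarrow> 'q option \<Rightarrow> ('c \<rightharpoonup> 'q)" where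
  "pbind c t = (case (c, t) of (Some c, Some L) \<Rightarrow> [c \<mapsto> L] | _ \<Rightarrow> Map.empty)"

text \<open>In \<open>send\<close> and \<open>recv\<close> below, the branches are \<open>(r i, l i, c i, P i)\<close>, resp.
  \<open>(r i, l i, y i, P i)\<close>, for \<open>i < n\<close>. In \<open>send\<close> the union of the bindings \<open>c i : L i\<close> is
  disjoint, so different branches send different endpoints.\<close>

inductive ptyp ::
  "('p, 'l, 'q) csm set \<Rightarrow> ('i \<Rightarrow> 'q list) \<Rightarrow> ('x, 's, 'p, 'q) gctx \<Rightarrow>
   ('p, 'l, 'q, 'x, 's, 'i) trm \<Rightarrow> bool"
  for \<U> \<Theta> where
  call: "\<lbrakk>length cs = length (\<Theta> i); distinct cs\<rbrakk> \<Longrightarrow>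
    ptyp \<U> \<Theta> (map_of (zip cs (\<Theta> i))) (Call i cs)"
| zero: "ptyp \<U> \<Theta> Map.empty Zero"
| weaken: "\<lbrakk>ptyp \<U> \<Theta> \<Gamma> P; End \<U> q; c \<notin> dom \<Gamma>\<rbrakk> \<Longrightarrow> ptyp \<U> \<Theta> (\<Gamma>(c \<mapsto> q)) P"
| par: "\<lbrakk>ptyp \<U> \<Theta> \<Gamma>1 P1; ptyp \<U> \<Theta> \<Gamma>2 P2; dom \<Gamma>1 \<inter> dom \<Gamma>2 = {}\<rbrakk> \<Longrightarrow>
    ptyp \<U> \<Theta> (\<Gamma>1 ++ \<Gamma>2) (Par P1 P2)"
| send: "\<lbrakk>n > 0; owner \<U> q p;
      {(Some (Snd p (r i) (l i, t i)), q' i) | i. i < n} \<subseteq> delta \<U> q;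
      \<forall>i<n. ch i = None \<longleftrightarrow> t i = None;
      ctx_disjoint {..<n} (\<lambda>i. pbind (ch i) (t i));
      c \<notin> dom \<Gamma>; c \<notin> dom (ctx_Union {..<n} (\<lambda>i. pbind (ch i) (t i)));
      dom \<Gamma> \<inter> dom (ctx_Union {..<n} (\<lambda>i. pbind (ch i) (t i))) = {};
      \<forall>i<n. ptyp \<U> \<Theta>
        (\<Gamma>(c \<mapsto> q' i) ++ ctx_Union ({..<n} - {i}) (\<lambda>j. pbind (ch j) (t j))) (P i)\<rbrakk> \<Longrightarrow>
    ptyp \<U> \<Theta> (\<Gamma>(c \<mapsto> q) ++ ctx_Union {..<n} (\<lambda>i. pbind (ch i) (t i)))
      (Send c (map (\<lambda>i. (r i, l i, ch i, P i)) [0..<n]))"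
| recv: "\<lbrakk>n > 0; owner \<U> q p;
      delta \<U> q = {(Some (Rcv (r i) p (l i, t i)), q' i) | i. i < n};
      \<forall>i<n. y i = None \<longleftrightarrow> t i = None;
      c \<notin> dom \<Gamma>;
      \<forall>i<n. \<forall>x. y i = Some x \<longrightarrow> Var x \<notin> dom \<Gamma> \<and> Var x \<noteq> c;
      \<forall>i<n. ptyp \<U> \<Theta> (\<Gamma>(c \<mapsto> q' i) ++ pbind (map_option Var (y i)) (t i)) (P i)\<rbrakk> \<Longrightarrow>
    ptyp \<U> \<Theta> (\<Gamma>(c \<mapsto> q)) (Recv c (map (\<lambda>i. (r i, l i, y i, P i)) [0..<n]))"

definition typable_defs ::
  "('p, 'l, 'q) csm set \<Rightarrow> ('i \<Rightarrow> 'q list) \<Rightarrow> ('p, 'l, 'q, 'x, 's, 'i) defs \<Rightarrow> bool" where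
  "typable_defs \<U> \<Theta> D \<longleftrightarrow>
    (\<forall>i xs P. D i = (xs, P) \<longrightarrow>
       length xs = length (\<Theta> i) \<and> ptyp \<U> \<Theta> (map_of (zip (map Var xs) (\<Theta> i))) P)"

text \<open>\<open>Ps\<close> is the set of participants of the session.
  Queues are built from the empty ones by adding messages at the front.\<close>

inductive qtyp ::
  "('p, 'l, 'q) csm set \<Rightarrow> 'p set \<Rightarrow> ('x, 's, 'p, 'q) gctx \<Rightarrow> ('s, 'p, 'l, 'q) dctx \<Rightarrow>
   's \<Rightarrow> ('p, 'l, 's) queues \<Rightarrow> bool"
  for \<U> Ps where
  empty: "qtyp \<U> Ps Map.empty
    (\<lambda>(s', p, r). if s' = s \<and> p \<in> Ps \<and> r \<in> Ps \<and> p \<noteq> r then Some [] else None) s empty_queues"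
| msg: "\<lbrakk>qtyp \<U> Ps \<Gamma> \<Delta> s \<sigma>; \<Delta> (s, p, r) = Some \<tau>; val_ep v \<notin> dom \<Gamma>\<rbrakk> \<Longrightarrow>
    qtyp \<U> Ps (\<Gamma>(val_ep v \<mapsto> L)) (\<Delta>((s, p, r) \<mapsto> (l, Some L) # \<tau>)) s
      (chan_upd \<sigma> p r ((l, Some v) # \<sigma> p r))"
| msg_no_payload: "\<lbrakk>qtyp \<U> Ps \<Gamma> \<Delta> s \<sigma>; \<Delta> (s, p, r) = Some \<tau>\<rbrakk> \<Longrightarrow>
    qtyp \<U> Ps \<Gamma> (\<Delta>((s, p, r) \<mapsto> (l, None) # \<tau>)) s (chan_upd \<sigma> p r ((l, None) # \<sigma> p r))"
| weaken: "\<lbrakk>qtyp \<U> Ps \<Gamma> \<Delta> s \<sigma>; End \<U> q; c \<notin> dom \<Gamma>\<rbrakk> \<Longrightarrow> qtyp \<U> Ps (\<Gamma>(c \<mapsto> q)) \<Delta> s \<sigma>"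

definition Gamma_of :: "('p, 'l, 'q) csm \<Rightarrow> 's \<Rightarrow> ('p \<Rightarrow> 'q) \<Rightarrow> ('x, 's, 'p, 'q) gctx" where
  "Gamma_of A s q =
    (\<lambda>c. case c of Var x \<Rightarrow> None
       | EP s' p \<Rightarrow> if s' = s \<and> p \<in> parts A then Some (q p) else None)"

definition Delta_of ::
  "('p, 'l, 'q) csm \<Rightarrow> 's \<Rightarrow> ('p \<Rightarrow> 'p \<Rightarrow> ('l, 'q) msg list) \<Rightarrow> ('s, 'p, 'l, 'q) dctx" where
  "Delta_of A s \<xi> =
    (\<lambda>(s', p, r). if s' = s \<and> p \<in> parts A \<and> r \<in> parts A \<and> p \<noteq> r then Some (\<xi> p r) else None)"

definition big_par :: "('p, 'l, 'q, 'x, 's, 'i) trm list \<Rightarrow> ('p, 'l, 'q, 'x, 's, 'i) trm" where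
  "big_par Ps = foldr Par Ps Zero"

definition sf_typ ::
  "('p, 'l, 'q) csm set \<Rightarrow> ('i \<Rightarrow> 'q list) \<Rightarrow> ('p, 'l, 'q) csm \<Rightarrow> 's \<Rightarrow>
   ('x, 's, 'p, 'q) gctx \<Rightarrow> ('s, 'p, 'l, 'q) dctx \<Rightarrow> ('p, 'l, 'q, 'x, 's, 'i) trm \<Rightarrow> bool" where
  "sf_typ \<U> \<Theta> A s \<Gamma> \<Delta> R \<longleftrightarrow> is_rt R \<and>
    (\<exists>q \<xi> ps Q \<sigma> \<Gamma>p \<Gamma>'.
       \<Delta> = Delta_of A s \<xi> \<and> (q, \<xi>) \<in> reach A \<and>
       distinct ps \<and> set ps = parts A \<and> (\<forall>p\<in>parts A. is_proc (Q p)) \<and>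
       scong R (Par (big_par (map Q ps)) (Queue s \<sigma>)) \<and>
       ctx_disjoint (parts A) \<Gamma>p \<and>
       dom (Gamma_of A s q) \<inter> dom (ctx_Union (parts A) \<Gamma>p) = {} \<and>
       dom (Gamma_of A s q) \<inter> dom \<Gamma>' = {} \<and> dom (ctx_Union (parts A) \<Gamma>p) \<inter> dom \<Gamma>' = {} \<and>
       \<Gamma> = Gamma_of A s q ++ ctx_Union (parts A) \<Gamma>p ++ \<Gamma>' \<and>
       (\<forall>p\<in>parts A. \<forall>c q'. \<Gamma>p p c = Some q' \<longrightarrow> End \<U> q') \<and>
       (\<forall>p\<in>parts A. ptyp \<U> \<Theta> ((\<Gamma>p p)(EP s p \<mapsto> q p)) (Q p)) \<and>
       qtyp \<U> (parts A) \<Gamma>' \<Delta> s \<sigma>)"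

end

theory Submission
  imports Defs
begin

text \<open>The typing context consists of the bindings \<open>s[p] : q p\<close> alone. Hence each process owns
  exactly its endpoint, the queues carry no payload, and no payload can be sent. By sink-finality an
  endpoint that is discarded by weakening has no outgoing transition. So the participant \<open>p\<close> that
  performs the given step of the CSM is implemented by a choice on \<open>s[p]\<close>, possibly below a call.
  An internal choice can fire, and each of its branches is a transition of the CSM. An external choice
  offers all transitions of \<open>q p\<close>, so the given step is a reception, whose message is at the head of
  the queue.\<close>

section \<open>Structural congruence\<close>

text \<open>The given step only selects a participant. Typing an internal choice asks for inclusion
  in the outgoing transitions, so a given \<epsilon>-step or reception may be answered by a send
  from the same state. Three mismatches shape the supporting lemmas. A call is typed through the
  formal parameters of its definition but unfolds with actual endpoints, so typing must be stable
  under substitution; contexts being linear, this is proved for substitutions injective on the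
  context. Queue typing grows from the front, whereas a send appends at the rear. Session-fidelity
  typing hides its configuration behind existential quantifiers, so that configuration has to be
  recovered from the contexts. Components owning no endpoint may stand beside the choice; they are
  typed in the empty context and carried along unchanged.\<close>

lemma symclp_comm: "symclp r x y \<Longrightarrow> symclp r y x"
  by (auto simp: symclp_def)

text \<open>The precongruence has no symmetry rule. Every closure rule can be read in both
  directions, so symmetry of the generating relation is inherited.\<close>

lemma precong_symclp_sym: "precong (symclp B) R R' \<Longrightarrow> precong (symclp B) R' R"
  by (induction rule: precong.induct) (auto intro: precong.intros symclp_comm)

lemma scong_refl: "scong R R"
  by (simp add: scong_def precong.refl)

lemma scong_trans [trans]: "scong R1 R2 \<Longrightarrow> scong R2 R3 \<Longrightarrow> scong R1 R3"
  unfolding scong_def by (rule precong.trans)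

lemma scong_sym: "scong R R' \<Longrightarrow> scong R' R"
  unfolding scong_def by (rule precong_symclp_sym)

lemma scong_par: "scong R1 R1' \<Longrightarrow> scong R2 R2' \<Longrightarrow> scong (Par R1 R2) (Par R1' R2')"
  unfolding scong_def by (rule precong.par)

lemma scong_axI: "scong_ax R R' \<Longrightarrow> scong R R'"
  unfolding scong_def by (rule precong.base) (simp add: symclp_def)

lemma scong_comm: "scong (Par R1 R2) (Par R2 R1)"
  by (rule scong_axI) (rule scong_ax.comm)

lemma scong_assoc: "scong (Par (Par R1 R2) R3) (Par R1 (Par R2 R3))"
  by (rule scong_axI) (rule scong_ax.assoc)

lemma scong_zero: "scong (Par R Zero) R"
  by (rule scong_axI) (rule scong_ax.zero)

lemma scong_par_left_comm: "scong (Par R1 (Par R2 R3)) (Par R2 (Par R1 R3))"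
proof -
  have "scong (Par R1 (Par R2 R3)) (Par (Par R1 R2) R3)" by (rule scong_sym[OF scong_assoc])
  also have "scong \<dots> (Par (Par R2 R1) R3)" by (intro scong_par scong_comm scong_refl)
  also have "scong \<dots> (Par R2 (Par R1 R3))" by (rule scong_assoc)
  finally show ?thesis .
qed

lemma scong_par_swap_tail: "scong (Par (Par R1 R2) R3) (Par (Par R1 R3) R2)"
proof -
  have "scong (Par (Par R1 R2) R3) (Par R1 (Par R2 R3))" by (rule scong_assoc)
  also have "scong \<dots> (Par R1 (Par R3 R2))" by (intro scong_par scong_comm scong_refl)
  also have "scong \<dots> (Par (Par R1 R3) R2)" by (rule scong_sym[OF scong_assoc])
  finally show ?thesis .
qed

lemma scong_imp_sprec: "scong R R' \<Longrightarrow> sprec R R'"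
  unfolding sprec_def by (intro precong.base sprec_ax.cong)

lemma red_scong: "scong R R1 \<Longrightarrow> red D R1 R2 \<Longrightarrow> scong R2 R' \<Longrightarrow> red D R R'"
  by (blast intro: red.struct scong_imp_sprec)

lemma red_par_left: "red D R R' \<Longrightarrow> red D (Par R S) (Par R' S)"
  using red.ctx[of D R R' "ParL Hole S"] by simp

lemma scong_big_par_remove1:
  "p \<in> set ps \<Longrightarrow> scong (big_par (map Q ps)) (Par (Q p) (big_par (map Q (remove1 p ps))))"
proof (induction ps)
  case (Cons a ps)
  show ?case
  proof (cases "a = p")
    case True
    then show ?thesis by (simp add: big_par_def scong_refl)
  next
    case False
    with Cons have "scong (big_par (map Q ps)) (Par (Q p) (big_par (map Q (remove1 p ps))))"
      by simp
    then have "scong (Par (Q a) (big_par (map Q ps)))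
        (Par (Q a) (Par (Q p) (big_par (map Q (remove1 p ps)))))"
      by (intro scong_par scong_refl)
    also have "scong \<dots> (Par (Q p) (Par (Q a) (big_par (map Q (remove1 p ps)))))"
      by (rule scong_par_left_comm)
    finally show ?thesis using False by (simp add: big_par_def)
  qed
qed simp

section \<open>Closure of processes under parallel composition and substitution\<close>

lemma is_proc_big_par: "\<forall>P\<in>set Ps. is_proc P \<Longrightarrow> is_proc (big_par Ps)"
  by (induction Ps) (auto simp: big_par_def intro: is_proc.intros)

lemma is_proc_imp_is_rt: "is_proc P \<Longrightarrow> is_rt P"
  by (induction rule: is_proc.induct) (auto intro: is_proc.intros)

lemma is_proc_subst: "is_proc P \<Longrightarrow> is_proc (subst f P)"
proof (induction arbitrary: f rule: is_proc.induct)
  case (4 bs c)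
  have "is_proc (subst f P)" if "(r, l, v, P) \<in> set bs" for r l v P
    using bspec[OF 4(2) that] by simp
  with 4(1) show ?case by (auto intro!: is_proc.intros(4))
next
  case (5 bs c)
  have "is_proc (subst g P)" if "(r, l, y, P) \<in> set bs" for r l y P g
    using bspec[OF 5(2) that] by simp
  with 5(1) show ?case by (auto intro!: is_proc.intros(5))
qed (simp_all add: is_proc.intros)

section \<open>Typing contexts\<close>

lemma map_eqI_Some: "(\<And>x y. m x = Some y \<longleftrightarrow> m' x = Some y) \<Longrightarrow> m = m'"
  by (rule ext) (smt (verit) option.collapse option.distinct(1))

text \<open>Disjointness makes the index chosen by \<open>THE\<close> unique. All later reasoning
  about unions goes through this existential form.\<close>

lemma ctx_Union_eq_Some_iff:
  assumes "ctx_disjoint I F"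
  shows "ctx_Union I F c = Some q \<longleftrightarrow> (\<exists>i\<in>I. F i c = Some q)"
proof (cases "\<exists>i\<in>I. c \<in> dom (F i)")
  case True
  then obtain i where i: "i \<in> I" "c \<in> dom (F i)" by blast
  have uniq: "j = i" if "j \<in> I" "c \<in> dom (F j)" for j
    using assms[unfolded ctx_disjoint_def] disjoint_family_onD[of _ I i j] i that by blast
  have "(THE j. j \<in> I \<and> c \<in> dom (F j)) = i"
    using i uniq by (intro the_equality conjI) blast+
  then have "ctx_Union I F c = F i c" using True by (simp only: ctx_Union_def if_True)
  then show ?thesis using i(1) uniq[OF _ domI] by (auto simp only:)
next
  case False
  then have "ctx_Union I F c = None" by (simp only: ctx_Union_def if_False)
  then show ?thesis using False by auto
qed

lemma dom_ctx_Union: "ctx_disjoint I F \<Longrightarrow> dom (ctx_Union I F) = (\<Union>i\<in>I. dom (F i))"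
  unfolding dom_def not_None_eq using ctx_Union_eq_Some_iff[of I F] by fast

lemma ctx_Union_empty: "\<forall>i\<in>I. F i = Map.empty \<Longrightarrow> ctx_Union I F = Map.empty"
  by (auto simp: ctx_Union_def)

lemma ctx_disjoint_mono: "ctx_disjoint I F \<Longrightarrow> J \<subseteq> I \<Longrightarrow> ctx_disjoint J F"
  unfolding ctx_disjoint_def by (rule disjoint_family_on_mono)

text \<open>The image of a context under a map of endpoints. The preimage is chosen by
  \<open>inv_into\<close>, so the result is meaningful when \<open>g\<close> is injective on the
  domain; otherwise bindings that are merged would compete for one key.\<close>

definition ctx_ren :: "('c \<Rightarrow> 'c) \<Rightarrow> ('c \<rightharpoonup> 'q) \<Rightarrow> ('c \<rightharpoonup> 'q)" where
  "ctx_ren g \<Gamma> = (\<lambda>d. if d \<in> g ` dom \<Gamma> then \<Gamma> (inv_into (dom \<Gamma>) g d) else None)"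

lemma ctx_ren_eq_Some_iff:
  "inj_on g (dom \<Gamma>) \<Longrightarrow> ctx_ren g \<Gamma> d = Some q \<longleftrightarrow> (\<exists>c. g c = d \<and> \<Gamma> c = Some q)"
proof -
  assume inj: "inj_on g (dom \<Gamma>)"
  have at_image: "ctx_ren g \<Gamma> (g c) = \<Gamma> c" if "c \<in> dom \<Gamma>" for c
    using inj that by (simp only: ctx_ren_def inv_into_f_f imageI if_True)
  show ?thesis
  proof (cases "d \<in> g ` dom \<Gamma>")
    case True
    then obtain c where c: "c \<in> dom \<Gamma>" "d = g c" by blast
    have "c' = c" if "g c' = d" "\<Gamma> c' = Some q" for c'
      using inj_onD[OF inj] c that by blast
    then show ?thesis using at_image[OF c(1)] c by auto
  next
    case False
    then show ?thesis by (auto simp: ctx_ren_def)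
  qed
qed

lemma dom_ctx_ren: "dom (ctx_ren g \<Gamma>) = g ` dom \<Gamma>"
proof -
  have "\<Gamma> (inv_into (dom \<Gamma>) g d) \<noteq> None" if "d \<in> g ` dom \<Gamma>" for d
    using inv_into_into[OF that] by blast
  then show ?thesis unfolding ctx_ren_def dom_def[of "\<lambda>d. if _ d then _ d else _"] by (auto simp del: domIff)
qed

lemma ctx_ren_eq_None_iff: "ctx_ren g \<Gamma> d = None \<longleftrightarrow> (\<forall>c. g c = d \<longrightarrow> \<Gamma> c = None)"
proof -
  have "ctx_ren g \<Gamma> d = None \<longleftrightarrow> d \<notin> g ` dom \<Gamma>"
    unfolding dom_ctx_ren[symmetric] domIff by simp
  also have "\<dots> \<longleftrightarrow> (\<forall>c. g c = d \<longrightarrow> \<Gamma> c = None)"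
    by (auto simp: dom_def)
  finally show ?thesis .
qed

lemma ctx_ren_empty [simp]: "ctx_ren g Map.empty = Map.empty"
  by (simp add: ctx_ren_def)

lemma ctx_ren_upd:
  assumes "inj_on g (insert c (dom \<Gamma>))"
  shows "ctx_ren g (\<Gamma>(c \<mapsto> q)) = (ctx_ren g \<Gamma>)(g c \<mapsto> q)"
proof (rule map_eqI_Some)
  fix d q'
  have "inj_on g (dom \<Gamma>)" "inj_on g (dom (\<Gamma>(c \<mapsto> q)))"
    using assms by (auto intro: inj_on_subset)
  then show "ctx_ren g (\<Gamma>(c \<mapsto> q)) d = Some q' \<longleftrightarrow> ((ctx_ren g \<Gamma>)(g c \<mapsto> q)) d = Some q'"
    using assms by (auto simp: ctx_ren_eq_Some_iff inj_on_def domI)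
qed

lemma ctx_ren_add:
  assumes "inj_on g (dom \<Gamma>1 \<union> dom \<Gamma>2)"
  shows "ctx_ren g (\<Gamma>1 ++ \<Gamma>2) = ctx_ren g \<Gamma>1 ++ ctx_ren g \<Gamma>2"
proof (rule map_eqI_Some)
  fix d q
  have inj: "inj_on g (dom \<Gamma>1)" "inj_on g (dom \<Gamma>2)" "inj_on g (dom (\<Gamma>1 ++ \<Gamma>2))"
    using assms by (auto intro: inj_on_subset simp: Un_commute)
  \<comment> \<open>In \<open>++\<close> the right operand takes precedence. Without injectivity,
    some \<open>c'\<close> bound in \<Gamma>2 could be renamed to the image of \<open>c\<close> and
    shadow the binding taken from \<Gamma>1.\<close>
  have same: "\<Gamma>2 c' = None" if "\<Gamma>2 c = None" "\<Gamma>1 c = Some q" "g c = d" "g c' = d" for c c'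
  proof (rule ccontr)
    assume "\<Gamma>2 c' \<noteq> None"
    then have "c = c'" using inj_onD[OF assms, of c c'] that by (simp add: domIff)
    with that(1) \<open>\<Gamma>2 c' \<noteq> None\<close> show False by simp
  qed
  show "ctx_ren g (\<Gamma>1 ++ \<Gamma>2) d = Some q \<longleftrightarrow> (ctx_ren g \<Gamma>1 ++ ctx_ren g \<Gamma>2) d = Some q"
    unfolding map_add_Some_iff ctx_ren_eq_None_iff ctx_ren_eq_Some_iff[OF inj(1)]
      ctx_ren_eq_Some_iff[OF inj(2)] ctx_ren_eq_Some_iff[OF inj(3)]
  proof (intro iffI; elim exE conjE disjE)
    fix c assume "g c = d" "\<Gamma>2 c = None" "\<Gamma>1 c = Some q"
    then show "(\<exists>c. g c = d \<and> \<Gamma>2 c = Some q) \<or>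
        (\<forall>c. g c = d \<longrightarrow> \<Gamma>2 c = None) \<and> (\<exists>c. g c = d \<and> \<Gamma>1 c = Some q)"
      using same by blast
  qed blast+
qed

lemma ctx_ren_cong: "(\<And>c. c \<in> dom \<Gamma> \<Longrightarrow> g c = g' c) \<Longrightarrow> ctx_ren g \<Gamma> = ctx_ren g' \<Gamma>"
proof -
  assume *: "\<And>c. c \<in> dom \<Gamma> \<Longrightarrow> g c = g' c"
  then have "g ` dom \<Gamma> = g' ` dom \<Gamma>" by (rule image_cong[OF HOL.refl])
  moreover have "inv_into (dom \<Gamma>) g = inv_into (dom \<Gamma>) g'"
    unfolding inv_into_def using * by (intro ext arg_cong[where f = Eps]) (auto dest: sym)
  ultimately show ?thesis by (simp only: ctx_ren_def)
qed

lemma ctx_disjoint_ren: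
  assumes "ctx_disjoint I F" "inj_on g (\<Union>i\<in>I. dom (F i))"
  shows "ctx_disjoint I (\<lambda>i. ctx_ren g (F i))"
  unfolding ctx_disjoint_def disjoint_family_on_def dom_ctx_ren
proof (intro ballI impI)
  fix i j assume *: "i \<in> I" "j \<in> I" "i \<noteq> j"
  then have "dom (F i) \<inter> dom (F j) = {}"
    using assms(1) by (auto simp: ctx_disjoint_def disjoint_family_on_def)
  with * show "g ` dom (F i) \<inter> g ` dom (F j) = {}"
    using inj_on_image_Int[OF assms(2), of "dom (F i)" "dom (F j)"] by (metis UN_upper image_empty)
qed

lemma ctx_ren_Union:
  assumes "ctx_disjoint I F" "inj_on g (\<Union>i\<in>I. dom (F i))"
  shows "ctx_ren g (ctx_Union I F) = ctx_Union I (\<lambda>i. ctx_ren g (F i))"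
proof (rule map_eqI_Some)
  fix d q
  have inj: "inj_on g (dom (ctx_Union I F))" "\<And>i. i \<in> I \<Longrightarrow> inj_on g (dom (F i))"
    using assms by (auto simp: dom_ctx_Union intro: inj_on_subset)
  show "ctx_ren g (ctx_Union I F) d = Some q \<longleftrightarrow> ctx_Union I (\<lambda>i. ctx_ren g (F i)) d = Some q"
    using inj by (auto simp: ctx_ren_eq_Some_iff ctx_Union_eq_Some_iff[OF assms(1)]
        ctx_Union_eq_Some_iff[OF ctx_disjoint_ren[OF assms]])
qed

lemma ctx_ren_pbind: "ctx_ren g (pbind c t) = pbind (map_option g c) t"
  by (auto simp: pbind_def ctx_ren_upd split: option.splits)

lemma ctx_ren_map_of_zip:
  assumes "length cs = length Ls" "inj_on g (set cs)"
  shows "ctx_ren g (map_of (zip cs Ls)) = map_of (zip (map g cs) Ls)"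
  using assms
proof (induction cs Ls rule: list_induct2)
  case (Cons c cs L Ls)
  then have "inj_on g (insert c (dom (map_of (zip cs Ls))))" by simp
  from ctx_ren_upd[OF this, of L] show ?case
    using Cons.IH Cons.prems by (simp del: fun_upd_apply)
qed simp

lemma dom_pbind_subset: "dom (pbind c t) \<subseteq> set_option c"
  by (auto simp: pbind_def split: option.splits)

lemma pbind_eq_empty_iff: "pbind c t = Map.empty \<longleftrightarrow> c = None \<or> t = None"
  by (auto simp: pbind_def split: option.splits)

section \<open>Substitution of values\<close>

text \<open>Substituting values or leaving a variable as it is cannot capture variables.\<close>

definition val_subst :: "('x \<Rightarrow> ('x, 's, 'p) endpoint) \<Rightarrow> bool" where
  "val_subst f \<longleftrightarrow> (\<forall>x. f x = Var x \<or> ep_vars (f x) = {})"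

text \<open>A value contains no variable, so a variable in the image was left in place. This is what
  excludes capture below the binders of an external choice.\<close>

lemma val_subst_eq_Var: "val_subst f \<Longrightarrow> ep_subst f c = Var x \<Longrightarrow> c = Var x"
  by (cases c) (auto simp: val_subst_def, metis empty_iff endpoint.inject(1) endpoint.set_intros(1))

text \<open>Serves to type the body of a called definition. Injectivity on the domain preserves the
  freshness and disjointness conditions of the rules. The substitution is arbitrary in the induction
  because \<open>subst\<close> changes it below each binder.\<close>

lemma ptyp_subst:
  assumes "ptyp \<U> \<Theta> \<Gamma> P" "val_subst f" "inj_on (ep_subst f) (dom \<Gamma>)"
  shows "ptyp \<U> \<Theta> (ctx_ren (ep_subst f) \<Gamma>) (subst f P)"
  using assms
proof (induction arbitrary: f rule: ptyp.induct)
  case (call cs i)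
  then have "inj_on (ep_subst f) (set cs)" by simp
  with call show ?case
    by (simp add: ctx_ren_map_of_zip) (rule ptyp.call, auto simp: distinct_map)
next
  case zero
  then show ?case by (simp add: ptyp.zero)
next
  case (weaken \<Gamma> P q c)
  have inj: "inj_on (ep_subst f) (insert c (dom \<Gamma>))"
    using weaken.prems(2) by (simp only: dom_fun_upd option.distinct if_False)
  then have "ep_subst f c \<notin> dom (ctx_ren (ep_subst f) \<Gamma>)"
    using weaken.hyps by (auto simp: dom_ctx_ren inj_on_def)
  moreover have "ptyp \<U> \<Theta> (ctx_ren (ep_subst f) \<Gamma>) (subst f P)"
    using weaken inj by (meson inj_on_insert)
  ultimately show ?case
    unfolding ctx_ren_upd[OF inj] using weaken.hyps(2) by (intro ptyp.weaken)
next
  case (par \<Gamma>1 P1 \<Gamma>2 P2)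
  then have inj: "inj_on (ep_subst f) (dom \<Gamma>1 \<union> dom \<Gamma>2)" by (simp add: Un_commute)
  then have "ptyp \<U> \<Theta> (ctx_ren (ep_subst f) \<Gamma>1) (subst f P1)"
    "ptyp \<U> \<Theta> (ctx_ren (ep_subst f) \<Gamma>2) (subst f P2)"
    using par by (meson inj_on_Un)+
  moreover have "dom (ctx_ren (ep_subst f) \<Gamma>1) \<inter> dom (ctx_ren (ep_subst f) \<Gamma>2) = {}"
    using inj par.hyps(3) by (simp add: dom_ctx_ren inj_on_image_Int[symmetric])
  ultimately show ?case
    using inj by (simp add: ctx_ren_add ptyp.par)
next
  case (send n q p r l t q' ch c \<Gamma> P)
  let ?g = "ep_subst f"
  let ?B = "\<lambda>i. pbind (ch i) (t i)"
  let ?U = "ctx_Union {..<n} ?B"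
  have domU: "dom ?U = (\<Union>i\<in>{..<n}. dom (?B i))"
    using send.hyps(5) by (rule dom_ctx_Union)
  have inj: "inj_on ?g (insert c (dom \<Gamma>) \<union> dom ?U)"
    using send.prems(2) by (simp add: Un_commute)
  then have injU: "inj_on ?g (\<Union>i\<in>{..<n}. dom (?B i))" and inj\<Gamma>: "inj_on ?g (insert c (dom \<Gamma>))"
    unfolding domU by (auto intro: inj_on_subset)
  have renU: "ctx_ren ?g ?U = ctx_Union {..<n} (\<lambda>i. pbind (map_option ?g (ch i)) (t i))"
    using ctx_ren_Union[OF send.hyps(5) injU] by (simp add: ctx_ren_pbind)
  have disj: "ctx_disjoint {..<n} (\<lambda>i. pbind (map_option ?g (ch i)) (t i))"
    using ctx_disjoint_ren[OF send.hyps(5) injU] by (simp add: ctx_ren_pbind)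
  have "ptyp \<U> \<Theta> ((ctx_ren ?g \<Gamma>)(?g c \<mapsto> q) ++ ctx_Union {..<n} (\<lambda>i. pbind (map_option ?g (ch i)) (t i)))
      (Send (?g c) (map (\<lambda>i. (r i, l i, map_option ?g (ch i), subst f (P i))) [0..<n]))"
  proof (rule ptyp.send[OF send.hyps(1-3) _ disj])
    show "\<forall>i<n. (map_option ?g (ch i) = None) = (t i = None)" using send.hyps(4) by simp
    show "?g c \<notin> dom (ctx_ren ?g \<Gamma>)"
      using send.hyps(6) inj\<Gamma> by (auto simp: dom_ctx_ren inj_on_def)
    show "?g c \<notin> dom (ctx_Union {..<n} (\<lambda>i. pbind (map_option ?g (ch i)) (t i)))"
      unfolding renU[symmetric] dom_ctx_ren using send.hyps(7) inj by (auto simp: inj_on_def)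
    show "dom (ctx_ren ?g \<Gamma>) \<inter> dom (ctx_Union {..<n} (\<lambda>i. pbind (map_option ?g (ch i)) (t i))) = {}"
    proof -
      have "?g ` dom \<Gamma> \<inter> ?g ` dom ?U = ?g ` (dom \<Gamma> \<inter> dom ?U)"
        by (rule inj_on_image_Int[OF inj, symmetric]) blast+
      then show ?thesis unfolding renU[symmetric] dom_ctx_ren send.hyps(8) by (simp only: image_empty)
    qed
    show "\<forall>i<n. ptyp \<U> \<Theta> ((ctx_ren ?g \<Gamma>)(?g c \<mapsto> q' i) ++
        ctx_Union ({..<n} - {i}) (\<lambda>j. pbind (map_option ?g (ch j)) (t j))) (subst f (P i))"
    proof (intro allI impI)
      fix i assume i: "i < n"
      let ?U' = "ctx_Union ({..<n} - {i}) ?B"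
      have disj': "ctx_disjoint ({..<n} - {i}) ?B"
        using send.hyps(5) by (rule ctx_disjoint_mono) blast
      have inj': "inj_on ?g (dom (\<Gamma>(c \<mapsto> q' i)) \<union> dom ?U')"
        using inj by (rule inj_on_subset) (auto simp: dom_ctx_Union[OF disj'] domU)
      have injU': "inj_on ?g (\<Union>j\<in>{..<n} - {i}. dom (?B j))"
        using injU by (rule inj_on_subset) blast
      have "inj_on ?g (dom (\<Gamma>(c \<mapsto> q' i) ++ ?U'))" using inj' by (simp add: Un_commute)
      then have "ptyp \<U> \<Theta> (ctx_ren ?g (\<Gamma>(c \<mapsto> q' i) ++ ?U')) (subst f (P i))"
        using send.IH i send.prems(1) by blast
      then show "ptyp \<U> \<Theta> ((ctx_ren ?g \<Gamma>)(?g c \<mapsto> q' i) ++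
        ctx_Union ({..<n} - {i}) (\<lambda>j. pbind (map_option ?g (ch j)) (t j))) (subst f (P i))"
        unfolding ctx_ren_add[OF inj'] ctx_ren_upd[OF inj\<Gamma>] ctx_ren_Union[OF disj' injU'] ctx_ren_pbind .
    qed
  qed
  then show ?case
    using inj by (simp add: ctx_ren_add ctx_ren_upd[OF inj\<Gamma>] renU o_def)
next
  case (recv n q p r l t q' y c \<Gamma> P)
  let ?g = "ep_subst f"
  let ?f = "\<lambda>i x. if y i = Some x then Var x else f x"
  have inj: "inj_on ?g (insert c (dom \<Gamma>))"
    using recv.prems(2) by (simp only: dom_fun_upd option.distinct if_False)
  have "ptyp \<U> \<Theta> ((ctx_ren ?g \<Gamma>)(?g c \<mapsto> q))
      (Recv (?g c) (map (\<lambda>i. (r i, l i, y i, subst (?f i) (P i))) [0..<n]))"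
  proof (rule ptyp.recv[OF recv.hyps(1-4)])
    show "?g c \<notin> dom (ctx_ren ?g \<Gamma>)"
      using recv.hyps(5) inj by (auto simp: dom_ctx_ren inj_on_def)
    show "\<forall>i<n. \<forall>x. y i = Some x \<longrightarrow> Var x \<notin> dom (ctx_ren ?g \<Gamma>) \<and> Var x \<noteq> ?g c"
    proof (intro allI impI)
      fix i x assume i: "i < n" "y i = Some x"
      \<comment> \<open>If \<open>z\<close> were sent to the bound variable, then \<open>z\<close>
        would be that variable itself, which the typing rule keeps apart from the subject and the
        context.\<close>
      have no_capture: "?g z \<noteq> Var x" if "z \<in> insert c (dom \<Gamma>)" for z
        using val_subst_eq_Var[OF recv.prems(1), of z x] recv.hyps(6) i that by blast
      show "Var x \<notin> dom (ctx_ren ?g \<Gamma>) \<and> Var x \<noteq> ?g c"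
        unfolding dom_ctx_ren
      proof (intro conjI notI)
        assume "Var x \<in> ?g ` dom \<Gamma>"
        then obtain z where "z \<in> dom \<Gamma>" "?g z = Var x" by (elim imageE) simp
        then show False using no_capture[of z] by simp
      next
        assume "Var x = ?g c"
        then show False using no_capture[of c] by simp
      qed
    qed
    show "\<forall>i<n. ptyp \<U> \<Theta> ((ctx_ren ?g \<Gamma>)(?g c \<mapsto> q' i) ++ pbind (map_option Var (y i)) (t i))
        (subst (?f i) (P i))"
    proof (intro allI impI)
      fix i assume i: "i < n"
      let ?g' = "ep_subst (?f i)"
      let ?B = "pbind (map_option Var (y i)) (t i)"
      have vs: "val_subst (?f i)" using recv.prems(1) by (auto simp: val_subst_def)
      have fresh: "z \<noteq> Var x" if "z \<in> insert c (dom \<Gamma>)" "y i = Some x" for z x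
        using recv.hyps(6) i that by blast
      \<comment> \<open>Below the binder the substitution differs only at the bound variable, which
        does not occur in the outer context. Hence the induction hypothesis for the modified
        substitution renames that context exactly as the original one does.\<close>
      have agree: "?g' z = ?g z" if "z \<in> insert c (dom \<Gamma>)" for z
        using fresh[OF that] by (cases z) auto
      have inj1: "inj_on ?g' (insert c (dom \<Gamma>))"
        by (rule iffD2[OF inj_on_cong inj]) (rule agree)
      have bound: "?g' (Var x) = Var x" if "y i = Some x" for x using that by simp
      have domB: "dom ?B \<subseteq> Var ` set_option (y i)"
        using dom_pbind_subset[of "map_option Var (y i)" "t i"] by (simp add: option.set_map)
      \<comment> \<open>The bound variable is fixed and nothing else is mapped to it; on the
        remaining endpoints injectivity comes from the outer context.\<close>
      have inj2: "inj_on ?g' (dom (\<Gamma>(c \<mapsto> q' i)) \<union> dom ?B)"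
      proof (rule inj_onI)
        fix a b assume ab: "a \<in> dom (\<Gamma>(c \<mapsto> q' i)) \<union> dom ?B" "b \<in> dom (\<Gamma>(c \<mapsto> q' i)) \<union> dom ?B"
          "?g' a = ?g' b"
        consider x where "y i = Some x" "a = Var x" | x where "y i = Some x" "b = Var x"
          | "a \<in> insert c (dom \<Gamma>)" "b \<in> insert c (dom \<Gamma>)"
          using ab(1,2) domB by (cases "y i") auto
        then show "a = b"
        proof cases
          case 1
          then show ?thesis using ab(3) bound[OF 1(1)] val_subst_eq_Var[OF vs, of b x] by simp
        next
          case 2
          then show ?thesis using ab(3) bound[OF 2(1)] val_subst_eq_Var[OF vs, of a x] by simp
        next
          case 3
          then show ?thesis using inj_onD[OF inj1 ab(3)] by blast
        qed
      qed
      then have "inj_on ?g' (dom (\<Gamma>(c \<mapsto> q' i) ++ ?B))" by (simp add: Un_commute)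
      then have "ptyp \<U> \<Theta> (ctx_ren ?g' (\<Gamma>(c \<mapsto> q' i) ++ ?B)) (subst (?f i) (P i))"
        using recv.IH i vs by blast
      moreover have "ctx_ren ?g' \<Gamma> = ctx_ren ?g \<Gamma>" by (rule ctx_ren_cong) (use agree in blast)
      moreover have "?g' c = ?g c" using agree by blast
      moreover have "map_option ?g' (map_option Var (y i)) = map_option Var (y i)"
        by (cases "y i") simp_all
      ultimately show "ptyp \<U> \<Theta> ((ctx_ren ?g \<Gamma>)(?g c \<mapsto> q' i) ++ ?B) (subst (?f i) (P i))"
        by (simp only: ctx_ren_add[OF inj2] ctx_ren_upd[OF inj1] ctx_ren_pbind)
    qed
  qed
  then show ?case
    by (simp only: ctx_ren_upd[OF inj] subst.simps list.map_comp o_def prod.case)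
qed

lemma ctx_ren_singleton: "ctx_ren g [c \<mapsto> q] = [g c \<mapsto> q]"
  using ctx_ren_upd[of g c Map.empty q] by simp

section \<open>Processes with a single session endpoint\<close>

text \<open>Restrictions have no typing rule, so \<open>ceil\<close> finds no session for which to
  create queues.\<close>

lemma ptyp_ceil: "ptyp \<U> \<Theta> \<Gamma> P \<Longrightarrow> ceil P = P"
  by (induction rule: ptyp.induct) simp_all

text \<open>Again because restrictions are untypable. It discharges the freshness condition on
  sessions when a call is instantiated.\<close>

lemma ptyp_bound_sess: "ptyp \<U> \<Theta> \<Gamma> P \<Longrightarrow> bound_sess P = {}"
proof (induction rule: ptyp.induct)
  case (send n q p r l t q' ch c \<Gamma> P)
  then show ?case by auto
next
  case (recv n q p r l t q' y c \<Gamma> P)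
  then show ?case by auto
qed simp_all

section \<open>Inversion of typing in a context with a single binding\<close>

lemma map_upd_eq_singleton_iff:
  "c' \<notin> dom \<Gamma> \<Longrightarrow> \<Gamma>(c' \<mapsto> q') = [c \<mapsto> q] \<longleftrightarrow> c' = c \<and> q' = q \<and> \<Gamma> = Map.empty"
proof
  assume fresh: "c' \<notin> dom \<Gamma>" and eq: "\<Gamma>(c' \<mapsto> q') = [c \<mapsto> q]"
  from fun_cong[OF eq, of c'] have c': "c' = c" "q' = q" by (simp_all split: if_splits)
  have "\<Gamma> x = None" for x
    using fun_cong[OF eq, of x] fresh c' by (cases "x = c") (simp_all add: domIff)
  with c' show "c' = c \<and> q' = q \<and> \<Gamma> = Map.empty" by (simp add: ext)
qed simp

lemma map_add_eq_singleton_cases: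
  assumes "\<Gamma>1 ++ \<Gamma>2 = [c \<mapsto> q]" "dom \<Gamma>1 \<inter> dom \<Gamma>2 = {}"
  obtains "\<Gamma>1 = [c \<mapsto> q]" "\<Gamma>2 = Map.empty" | "\<Gamma>1 = Map.empty" "\<Gamma>2 = [c \<mapsto> q]"
proof (cases "\<Gamma>2 c")
  case (Some a)
  have "\<Gamma>1 x = None" for x
    using fun_cong[OF assms(1), of x] assms(2) Some
    by (cases "x = c") (auto simp: map_add_def domI split: option.splits)
  then have "\<Gamma>1 = Map.empty" by (rule ext)
  with assms(1) that(2) show ?thesis by simp
next
  case None
  have "\<Gamma>2 x = None" for x
    using fun_cong[OF assms(1), of x] None
    by (cases "x = c") (auto simp: map_add_def split: option.splits)
  then have "\<Gamma>2 = Map.empty" by (rule ext)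
  with assms(1) that(1) show ?thesis by simp
qed

text \<open>Weakening only enlarges the context. The lemma refutes weakening as the last rule for a
  choice in a singleton context, since the subject would have to be bound in the empty
  context.\<close>

lemma ptyp_Send_dom: "ptyp \<U> \<Theta> \<Gamma> P \<Longrightarrow> P = Send c bs \<Longrightarrow> c \<in> dom \<Gamma>"
  by (induction rule: ptyp.induct) auto

lemma ptyp_Recv_dom: "ptyp \<U> \<Theta> \<Gamma> P \<Longrightarrow> P = Recv c bs \<Longrightarrow> c \<in> dom \<Gamma>"
  by (induction rule: ptyp.induct) auto

text \<open>The only endpoint is the subject of the choice, so no endpoint is left to be sent.\<close>

lemma ptyp_Send_singleton:
  assumes "ptyp \<U> \<Theta> [c \<mapsto> q] (Send c' bs)"
  shows "c' = c \<and> bs \<noteq> [] \<and> (\<exists>p. owner \<U> q p \<and>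
    (\<forall>(r, l, v, P)\<in>set bs. v = None \<and>
      (\<exists>q'. (Some (Snd p r (l, None)), q') \<in> delta \<U> q \<and> ptyp \<U> \<Theta> [c \<mapsto> q'] P)))"
proof -
  have "\<Gamma> = [c \<mapsto> q] \<Longrightarrow> X = Send c' bs \<Longrightarrow> ?thesis" if "ptyp \<U> \<Theta> \<Gamma> X" for \<Gamma> X
    using that
  proof (cases rule: ptyp.cases)
    case (weaken \<Gamma>' q1 c1)
    assume X: "\<Gamma> = [c \<mapsto> q]" "X = Send c' bs"
    with weaken(1) have "\<Gamma>'(c1 \<mapsto> q1) = [c \<mapsto> q]" by simp
    then have "\<Gamma>' = Map.empty" using map_upd_eq_singleton_iff[OF weaken(4)] by blast
    then show ?thesis using ptyp_Send_dom[OF weaken(2) X(2)] by simp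
  next
    case (send n q1 p r l t q' ch c1 \<Gamma>' P)
    assume X: "\<Gamma> = [c \<mapsto> q]" "X = Send c' bs"
    let ?B = "\<lambda>i. pbind (ch i) (t i)"
    let ?U = "ctx_Union {..<n} ?B"
    from send(1) X have eq: "\<Gamma>'(c1 \<mapsto> q1) ++ ?U = [c \<mapsto> q]" by simp
    have "dom (\<Gamma>'(c1 \<mapsto> q1)) \<inter> dom ?U = {}"
      using send(9,10) by (auto simp: dom_def)
    \<comment> \<open>The subject is bound in the left operand, so it accounts for the single
      binding and the union of payload bindings is empty.\<close>
    with eq have *: "\<Gamma>'(c1 \<mapsto> q1) = [c \<mapsto> q] \<and> ?U = Map.empty"
    proof (cases rule: map_add_eq_singleton_cases)
      case 2
      from fun_cong[OF 2(1), of c1] show ?thesis by simp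
    qed blast
    then have c1: "c1 = c" "q1 = q" "\<Gamma>' = Map.empty"
      using map_upd_eq_singleton_iff[OF send(8)] by blast+
    have B: "?B i = Map.empty" if "i < n" for i
      using dom_ctx_Union[OF send(7)] * that by simp
    \<comment> \<open>An empty payload binding lacks an endpoint or a type; the typing rule makes
      them absent together.\<close>
    then have none: "ch i = None \<and> t i = None" if "i < n" for i
      using that send(6) pbind_eq_empty_iff by metis
    have U': "ctx_Union ({..<n} - {i}) ?B = Map.empty" for i
      by (rule ctx_Union_empty) (use B in blast)
    have bs: "c' = c1" "bs = map (\<lambda>i. (r i, l i, ch i, P i)) [0..<n]"
      using send(2) X(2) by simp_all
    have branch: "ch i = None \<and> (\<exists>q'. (Some (Snd p (r i) (l i, None)), q') \<in> delta \<U> q \<and>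
        ptyp \<U> \<Theta> [c \<mapsto> q'] (P i))" if "i < n" for i
    proof (intro conjI exI)
      show "ch i = None" using none that by blast
      have "(Some (Snd p (r i) (l i, t i)), q' i) \<in> delta \<U> q1" using send(5) that by blast
      then show "(Some (Snd p (r i) (l i, None)), q' i) \<in> delta \<U> q" using none that c1 by simp
      show "ptyp \<U> \<Theta> [c \<mapsto> q' i] (P i)" using send(11) that by (simp add: U' c1)
    qed
    show ?thesis
    proof (intro conjI exI)
      show "c' = c" using bs c1 by simp
      show "bs \<noteq> []" using bs send(3) by simp
      show "owner \<U> q p" using send(4) c1 by simp
      show "\<forall>(r, l, v, P)\<in>set bs. v = None \<and>
        (\<exists>q'. (Some (Snd p r (l, None)), q') \<in> delta \<U> q \<and> ptyp \<U> \<Theta> [c \<mapsto> q'] P)"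
        unfolding bs using branch by simp
    qed
  qed simp_all
  with assms show ?thesis by blast
qed

text \<open>External choices are typed with an equality on outgoing transitions, so information
  flows from transitions to branches. Continuations are described only for receptions without
  payload: with a payload they would own a second endpoint. The typing of the queue later rules out
  that case.\<close>

lemma ptyp_Recv_singleton:
  assumes "ptyp \<U> \<Theta> [c \<mapsto> q] (Recv c' bs)"
  shows "c' = c \<and> (\<exists>p. owner \<U> q p \<and>
    (\<forall>(e, q')\<in>delta \<U> q. \<exists>r l t. e = Some (Rcv r p (l, t)) \<and>
      (t = None \<longrightarrow> (\<exists>P. (r, l, None, P) \<in> set bs \<and> ptyp \<U> \<Theta> [c \<mapsto> q'] P))))"
proof -
  have "\<Gamma> = [c \<mapsto> q] \<Longrightarrow> X = Recv c' bs \<Longrightarrow> ?thesis" if "ptyp \<U> \<Theta> \<Gamma> X" for \<Gamma> X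
    using that
  proof (cases rule: ptyp.cases)
    case (weaken \<Gamma>' q1 c1)
    assume X: "\<Gamma> = [c \<mapsto> q]" "X = Recv c' bs"
    with weaken(1) have "\<Gamma>'(c1 \<mapsto> q1) = [c \<mapsto> q]" by simp
    then have "\<Gamma>' = Map.empty" using map_upd_eq_singleton_iff[OF weaken(4)] by blast
    then show ?thesis using ptyp_Recv_dom[OF weaken(2) X(2)] by simp
  next
    case (recv n q1 p r l t q' y c1 \<Gamma>' P)
    assume X: "\<Gamma> = [c \<mapsto> q]" "X = Recv c' bs"
    from recv(1) X have "\<Gamma>'(c1 \<mapsto> q1) = [c \<mapsto> q]" by simp
    then have c1: "c1 = c" "q1 = q" "\<Gamma>' = Map.empty"
      using map_upd_eq_singleton_iff[OF recv(7)] by blast+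
    have bs: "c' = c1" "bs = map (\<lambda>i. (r i, l i, y i, P i)) [0..<n]"
      using recv(2) X(2) by simp_all
    have branch: "(r i, l i, None, P i) \<in> set bs \<and> ptyp \<U> \<Theta> [c \<mapsto> q' i] (P i)"
      if "i < n" "t i = None" for i
    proof
      have "y i = None" using recv(6) that by blast
      then show "(r i, l i, None, P i) \<in> set bs" unfolding bs using that(1) by force
      show "ptyp \<U> \<Theta> [c \<mapsto> q' i] (P i)"
        using recv(9)[rule_format, OF that(1)] \<open>y i = None\<close>
        by (simp only: c1 pbind_def option.map option.case prod.case map_add_empty)
    qed
    have "\<forall>(e, q')\<in>delta \<U> q. \<exists>r l t. e = Some (Rcv r p (l, t)) \<and>
      (t = None \<longrightarrow> (\<exists>P. (r, l, None, P) \<in> set bs \<and> ptyp \<U> \<Theta> [c \<mapsto> q'] P))"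
    proof (intro ballI, clarify)
      fix e q'' assume "(e, q'') \<in> delta \<U> q"
      then obtain i where i: "i < n" "e = Some (Rcv (r i) p (l i, t i))" "q'' = q' i"
        using recv(5) c1 by auto
      show "\<exists>r l t. e = Some (Rcv r p (l, t)) \<and>
        (t = None \<longrightarrow> (\<exists>P. (r, l, None, P) \<in> set bs \<and> ptyp \<U> \<Theta> [c \<mapsto> q''] P))"
        using i branch by blast
    qed
    then show ?thesis using bs c1 recv(4) by blast
  qed simp_all
  with assms show ?thesis by blast
qed

text \<open>Either the endpoint is discarded by weakening, or some parallel component owns it.\<close>

lemma ptyp_singleton_cases:
  assumes "ptyp \<U> \<Theta> \<Gamma> P" "is_proc P" "\<Gamma> = [c \<mapsto> q]"
  shows "End \<U> q \<or> (\<exists>P0 Z. scong P (Par P0 Z) \<and> is_proc P0 \<and> is_proc Z \<and>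
    ptyp \<U> \<Theta> [c \<mapsto> q] P0 \<and> ptyp \<U> \<Theta> Map.empty Z \<and>
    ((\<exists>i. P0 = Call i [c] \<and> \<Theta> i = [q]) \<or> (\<exists>d bs. P0 = Send d bs) \<or> (\<exists>d bs. P0 = Recv d bs)))"
proof -
  have leaf: "\<exists>P0 Z. scong X (Par P0 Z) \<and> is_proc P0 \<and> is_proc Z \<and>
      ptyp \<U> \<Theta> [c \<mapsto> q] P0 \<and> ptyp \<U> \<Theta> Map.empty Z \<and>
      ((\<exists>i. P0 = Call i [c] \<and> \<Theta> i = [q]) \<or> (\<exists>d bs. P0 = Send d bs) \<or> (\<exists>d bs. P0 = Recv d bs))"
    if "ptyp \<U> \<Theta> [c \<mapsto> q] X" "is_proc X"
      "(\<exists>i. X = Call i [c] \<and> \<Theta> i = [q]) \<or> (\<exists>d bs. X = Send d bs) \<or> (\<exists>d bs. X = Recv d bs)" for X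
    using that scong_sym[OF scong_zero[of X]] is_proc.intros(1) ptyp.zero by blast
  show ?thesis
    using assms
  proof (induction rule: ptyp.induct)
    case (call cs i)
    \<comment> \<open>The domain determines the set of arguments, and distinctness then leaves only
      the one-element list.\<close>
    from arg_cong[OF call.prems(2), of dom] have "set cs = {c}"
      using call.hyps(1) by (simp add: dom_map_of_zip del: fun_upd_apply)
    then have cs: "cs = [c]" using call.hyps(2)
      by (cases cs; cases "tl cs") auto
    with call.hyps(1) obtain L where L: "\<Theta> i = [L]" by (cases "\<Theta> i") auto
    with cs fun_cong[OF call.prems(2), of c] have "\<Theta> i = [q]" by simp
    moreover have "ptyp \<U> \<Theta> [c \<mapsto> q] (Call i cs)"
      unfolding call.prems(2)[symmetric] using call.hyps by (rule ptyp.call)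
    ultimately show ?case using leaf[of "Call i cs"] call.prems(1) cs by blast
  next
    case zero
    from fun_cong[OF zero.prems(2), of c] show ?case by simp
  next
    case (weaken \<Gamma> P q' c')
    \<comment> \<open>A weakened binding in a singleton context is the endpoint itself, which gives
      the first alternative.\<close>
    then have "q' = q" using map_upd_eq_singleton_iff[OF weaken.hyps(3)] by blast
    with weaken.hyps(2) show ?case by simp
  next
    case (par \<Gamma>1 P1 \<Gamma>2 P2)
    have procs: "is_proc P1" "is_proc P2"
      using par.prems(1) by (auto elim: is_proc.cases)
    from par.prems(2) par.hyps(3) show ?case
    proof (cases rule: map_add_eq_singleton_cases)
      case 1
      \<comment> \<open>The component that does not own the endpoint is typed in the empty context
        and joins the remainder \<open>Z\<close>.\<close>
      have "scong (Par P1 P2) (Par P0 (Par Z P2))" if "scong P1 (Par P0 Z)" for P0 Z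
        using scong_trans[OF scong_par[OF that scong_refl] scong_assoc] .
      moreover have "ptyp \<U> \<Theta> Map.empty (Par Z P2)" if "ptyp \<U> \<Theta> Map.empty Z" for Z
        using ptyp.par[OF that par.hyps(2)] 1 by simp
      ultimately show ?thesis
        using par.IH(1)[OF procs(1) 1(1)] procs(2) is_proc.intros(2) by metis
    next
      case 2
      have "scong (Par P1 P2) (Par P0 (Par P1 Z))" if "scong P2 (Par P0 Z)" for P0 Z
        using scong_trans[OF scong_par[OF scong_refl that] scong_par_left_comm] .
      moreover have "ptyp \<U> \<Theta> Map.empty (Par P1 Z)" if "ptyp \<U> \<Theta> Map.empty Z" for Z
        using ptyp.par[OF par.hyps(1) that] 2 by simp
      ultimately show ?thesis
        using par.IH(2)[OF procs(2) 2(2)] procs(1) is_proc.intros(2) by metis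
    qed
  next
    case (send n q0 p r l t q' ch c0 \<Gamma> P)
    have "ptyp \<U> \<Theta> (\<Gamma>(c0 \<mapsto> q0) ++ ctx_Union {..<n} (\<lambda>i. pbind (ch i) (t i)))
      (Send c0 (map (\<lambda>i. (r i, l i, ch i, P i)) [0..<n]))"
      by (rule ptyp.send[OF send.hyps]) (use send.IH in blast)
    from leaf[OF this[unfolded send.prems(2)] send.prems(1)] show ?case by blast
  next
    case (recv n q0 p r l t q' y c0 \<Gamma> P)
    have "ptyp \<U> \<Theta> (\<Gamma>(c0 \<mapsto> q0)) (Recv c0 (map (\<lambda>i. (r i, l i, y i, P i)) [0..<n]))"
      by (rule ptyp.recv[OF recv.hyps]) (use recv.IH in blast)
    from leaf[OF this[unfolded recv.prems(2)] recv.prems(1)] show ?case by blast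
  qed
qed

text \<open>Bodies of definitions are choices by well-formedness, so a call needs to be unfolded
  only once. The link between the component \<open>P0\<close> and the choice \<open>H\<close> is
  stated through reductions beside an arbitrary \<open>W\<close>, because unfolding is not a
  reduction by itself: the call rule transfers reductions of the unfolded term.\<close>

lemma ptyp_singleton_head:
  assumes D_ok: "wf_defs D" "typable_defs \<U> \<Theta> D"
    and P_ok: "ptyp \<U> \<Theta> [EP s p \<mapsto> q] P" "is_proc P"
  shows "End \<U> q \<or> (\<exists>P0 Z H. scong P (Par P0 Z) \<and> is_proc Z \<and> ptyp \<U> \<Theta> Map.empty Z \<and>
    (\<forall>W R'. red D (Par H W) R' \<longrightarrow> red D (Par P0 W) R') \<and>
    is_proc H \<and> ptyp \<U> \<Theta> [EP s p \<mapsto> q] H \<and> ((\<exists>d bs. H = Send d bs) \<or> (\<exists>d bs. H = Recv d bs)))"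
proof (cases "End \<U> q")
  case False
  then obtain P0 Z where P0: "scong P (Par P0 Z)" "is_proc P0" "is_proc Z"
      "ptyp \<U> \<Theta> [EP s p \<mapsto> q] P0" "ptyp \<U> \<Theta> Map.empty Z"
      "(\<exists>i. P0 = Call i [EP s p] \<and> \<Theta> i = [q]) \<or> (\<exists>d bs. P0 = Send d bs) \<or> (\<exists>d bs. P0 = Recv d bs)"
    using ptyp_singleton_cases[OF P_ok HOL.refl] by blast
  show ?thesis
  proof (cases "\<exists>i. P0 = Call i [EP s p] \<and> \<Theta> i = [q]")
    case False
    with P0 show ?thesis by blast
  next
    case True
    then obtain i where i: "P0 = Call i [EP s p]" "\<Theta> i = [q]" by blast
    obtain xs B where D: "D i = (xs, B)" by (cases "D i")
    with D_ok(2) i(2) have B: "length xs = 1" "ptyp \<U> \<Theta> (map_of (zip (map Var xs) [q])) B"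
      unfolding typable_defs_def by (metis One_nat_def length_Cons list.size(3))+
    then obtain x where x: "xs = [x]" by (cases xs) auto
    let ?f = "\<lambda>z. case map_of (zip xs [EP s p]) z of Some c \<Rightarrow> c | None \<Rightarrow> Var z"
    have Bx: "ptyp \<U> \<Theta> [Var x \<mapsto> q] B" using B(2) x by simp
    have "val_subst ?f" by (simp add: val_subst_def x)
    from ptyp_subst[OF Bx this] have "ptyp \<U> \<Theta> [ep_subst ?f (Var x) \<mapsto> q] (subst ?f B)"
      unfolding ctx_ren_singleton by simp
    then have typH: "ptyp \<U> \<Theta> [EP s p \<mapsto> q] (subst ?f B)" by (simp add: x)
    have Bwf: "is_proc B" "(\<exists>c bs. B = Send c bs) \<or> (\<exists>c bs. B = Recv c bs)"
      using D_ok(1) D unfolding wf_defs_def by blast+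
    \<comment> \<open>The body serves as its own \<alpha>-variant: the argument contains no
      variable, and the typed body binds no session.\<close>
    have "inst xs [EP s p] B (subst ?f B)"
      unfolding inst_def
    proof (intro conjI exI)
      show "length xs = length [EP s p]" by (simp add: x)
      show "alpha B B" by (simp add: alpha_def precong.refl)
      show "\<forall>c\<in>set [EP s p]. ep_vars c \<inter> bound_vars B = {} \<and> ep_sess c \<inter> bound_sess B = {}"
        using ptyp_bound_sess[OF Bx] by simp
    qed (rule HOL.refl)
    then have "red D (Par (subst ?f B) W) R' \<Longrightarrow> red D (Par P0 W) R'" for W R'
      unfolding i(1) using D by (intro red.call)
    moreover have "(\<exists>d bs. subst ?f B = Send d bs) \<or> (\<exists>d bs. subst ?f B = Recv d bs)"
      using Bwf(2) by auto
    moreover have "is_proc (subst ?f B)" using Bwf(1) by (rule is_proc_subst)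
    ultimately show ?thesis using P0(1,3,5) typH by blast
  qed
qed blast

section \<open>Queues without payloads\<close>

lemma chan_upd_same: "chan_upd f p r w p r = w"
  by (simp add: chan_upd_def)

lemma chan_upd_other: "(p', r') \<noteq> (p, r) \<Longrightarrow> chan_upd f p r w p' r' = f p' r'"
  by (auto simp: chan_upd_def)

lemma chan_upd_twice: "chan_upd (chan_upd f p r v) p r w = chan_upd f p r w"
  by (simp add: chan_upd_def)

lemma chan_upd_id: "chan_upd f p r (f p r) = f"
  by (simp add: chan_upd_def)

lemma chan_upd_commute:
  "(p, r) \<noteq> (p', r') \<Longrightarrow> chan_upd (chan_upd f p r v) p' r' w = chan_upd (chan_upd f p' r' w) p r v"
  by (rule ext, rule ext) (auto simp: chan_upd_def)

text \<open>The induction carries the new message down to the empty queues, where front and rear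
  coincide. Each front insertion of the derivation is then replayed, either on the same channel or
  on another one, with which the append commutes.\<close>

lemma qtyp_snoc:
  assumes "qtyp \<U> Ps \<Gamma> \<Delta> s \<sigma>" "\<Delta> (s, p, r) = Some \<tau>"
  shows "qtyp \<U> Ps \<Gamma> (\<Delta>((s, p, r) \<mapsto> \<tau> @ [(l, None)])) s (chan_upd \<sigma> p r (\<sigma> p r @ [(l, None)]))"
  using assms
proof (induction arbitrary: \<tau> rule: qtyp.induct)
  case (empty s)
  then have "\<tau> = []" by (simp split: if_splits)
  with qtyp.msg_no_payload[OF qtyp.empty empty] show ?case by (simp only: append_Nil)
next
  case (msg \<Gamma> \<Delta> s \<sigma> p' r' \<tau>' v L l')
  show ?case
  proof (cases "(p', r') = (p, r)")
    case True
    with msg.prems have "\<tau> = (l', Some L) # \<tau>'" by simp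
    moreover from True msg.hyps(2) have "\<Delta> (s, p, r) = Some \<tau>'" by simp
    from msg.IH[OF this] have "qtyp \<U> Ps (\<Gamma>(val_ep v \<mapsto> L))
        ((\<Delta>((s, p, r) \<mapsto> \<tau>' @ [(l, None)]))((s, p, r) \<mapsto> (l', Some L) # \<tau>' @ [(l, None)])) s
        (chan_upd (chan_upd \<sigma> p r (\<sigma> p r @ [(l, None)])) p r
          ((l', Some v) # chan_upd \<sigma> p r (\<sigma> p r @ [(l, None)]) p r))"
      by (rule qtyp.msg[OF _ _ msg.hyps(3)]) simp
    ultimately show ?thesis
      using True by (simp only: prod.inject chan_upd_same chan_upd_twice fun_upd_upd append_Cons)
  next
    case False
    with msg.prems have "\<Delta> (s, p, r) = Some \<tau>" by (auto split: if_splits)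
    from msg.IH[OF this] have "qtyp \<U> Ps (\<Gamma>(val_ep v \<mapsto> L))
        ((\<Delta>((s, p, r) \<mapsto> \<tau> @ [(l, None)]))((s, p', r') \<mapsto> (l', Some L) # \<tau>')) s
        (chan_upd (chan_upd \<sigma> p r (\<sigma> p r @ [(l, None)])) p' r'
          ((l', Some v) # chan_upd \<sigma> p r (\<sigma> p r @ [(l, None)]) p' r'))"
      by (rule qtyp.msg[OF _ _ msg.hyps(3)]) (use msg.hyps(2) False in auto)
    moreover have "\<Delta>((s, p, r) \<mapsto> x, (s, p', r') \<mapsto> y) = \<Delta>((s, p', r') \<mapsto> y, (s, p, r) \<mapsto> x)" for x y
      by (rule fun_upd_twist) (use False in auto)
    ultimately show ?thesis
      using False by (simp only: chan_upd_other[OF False] chan_upd_other[OF False[symmetric]]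
          chan_upd_commute[OF False[symmetric]])
  qed
next
  case (msg_no_payload \<Gamma> \<Delta> s \<sigma> p' r' \<tau>' l')
  show ?case
  proof (cases "(p', r') = (p, r)")
    case True
    with msg_no_payload.prems have "\<tau> = (l', None) # \<tau>'" by simp
    moreover from True msg_no_payload.hyps(2) have "\<Delta> (s, p, r) = Some \<tau>'" by simp
    from msg_no_payload.IH[OF this] have "qtyp \<U> Ps \<Gamma>
        ((\<Delta>((s, p, r) \<mapsto> \<tau>' @ [(l, None)]))((s, p, r) \<mapsto> (l', None) # \<tau>' @ [(l, None)])) s
        (chan_upd (chan_upd \<sigma> p r (\<sigma> p r @ [(l, None)])) p r
          ((l', None) # chan_upd \<sigma> p r (\<sigma> p r @ [(l, None)]) p r))"
      by (rule qtyp.msg_no_payload) simp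
    ultimately show ?thesis
      using True by (simp only: prod.inject chan_upd_same chan_upd_twice fun_upd_upd append_Cons)
  next
    case False
    with msg_no_payload.prems have "\<Delta> (s, p, r) = Some \<tau>" by (auto split: if_splits)
    from msg_no_payload.IH[OF this] have "qtyp \<U> Ps \<Gamma>
        ((\<Delta>((s, p, r) \<mapsto> \<tau> @ [(l, None)]))((s, p', r') \<mapsto> (l', None) # \<tau>')) s
        (chan_upd (chan_upd \<sigma> p r (\<sigma> p r @ [(l, None)])) p' r'
          ((l', None) # chan_upd \<sigma> p r (\<sigma> p r @ [(l, None)]) p' r'))"
      by (rule qtyp.msg_no_payload) (use msg_no_payload.hyps(2) False in auto)
    moreover have "\<Delta>((s, p, r) \<mapsto> x, (s, p', r') \<mapsto> y) = \<Delta>((s, p', r') \<mapsto> y, (s, p, r) \<mapsto> x)" for x y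
      by (rule fun_upd_twist) (use False in auto)
    ultimately show ?thesis
      using False by (simp only: chan_upd_other[OF False] chan_upd_other[OF False[symmetric]]
          chan_upd_commute[OF False[symmetric]])
  qed
next
  case (weaken \<Gamma> \<Delta> s \<sigma> q c)
  from weaken.IH[OF weaken.prems] weaken.hyps(2,3) show ?case by (rule qtyp.weaken)
qed

text \<open>An empty context has no binding for a payload.\<close>

lemma qtyp_pop:
  assumes "qtyp \<U> Ps \<Gamma> \<Delta> s \<sigma>" "\<Gamma> = Map.empty" "\<Delta> (s, p, r) = Some ((l, t) # \<tau>)"
  shows "t = None \<and> (\<exists>w. \<sigma> p r = (l, None) # w \<and>
    qtyp \<U> Ps \<Gamma> (\<Delta>((s, p, r) \<mapsto> \<tau>)) s (chan_upd \<sigma> p r w))"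
  using assms
proof (induction rule: qtyp.induct)
  case (empty s)
  then show ?case by (simp split: if_splits)
next
  case (msg \<Gamma> \<Delta> s \<sigma> p' r' \<tau>' v L l')
  from fun_cong[OF msg.prems(1), of "val_ep v"] show ?case by simp
next
  case (msg_no_payload \<Gamma> \<Delta> s \<sigma> p' r' \<tau>' l')
  show ?case
  proof (cases "(p', r') = (p, r)")
    case True
    with msg_no_payload.prems(2) have eqs: "p' = p" "r' = r" "l' = l" "t = None" "\<tau>' = \<tau>" by simp_all
    \<comment> \<open>The message added last is the one removed, so popping restores the preceding
      channel type and queue.\<close>
    have "\<Delta>((s, p, r) \<mapsto> \<tau>) = \<Delta>"
      using msg_no_payload.hyps(2) unfolding eqs by (intro fun_upd_idem)
    then show ?thesis
      using msg_no_payload.hyps(1) unfolding eqs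
      by (simp only: chan_upd_same chan_upd_twice fun_upd_upd chan_upd_id list.inject
          simp_thms ex_simps)
  next
    case False
    with msg_no_payload.prems(2) have "\<Delta> (s, p, r) = Some ((l, t) # \<tau>)" by (auto split: if_splits)
    from msg_no_payload.IH[OF msg_no_payload.prems(1) this] obtain w where
      w: "t = None" "\<sigma> p r = (l, None) # w"
        "qtyp \<U> Ps \<Gamma> (\<Delta>((s, p, r) \<mapsto> \<tau>)) s (chan_upd \<sigma> p r w)" by blast
    from w(3) have "qtyp \<U> Ps \<Gamma> ((\<Delta>((s, p, r) \<mapsto> \<tau>))((s, p', r') \<mapsto> (l', None) # \<tau>')) s
        (chan_upd (chan_upd \<sigma> p r w) p' r' ((l', None) # chan_upd \<sigma> p r w p' r'))"
      by (rule qtyp.msg_no_payload) (use msg_no_payload.hyps(2) False in auto)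
    moreover have "\<Delta>((s, p, r) \<mapsto> x, (s, p', r') \<mapsto> y) = \<Delta>((s, p', r') \<mapsto> y, (s, p, r) \<mapsto> x)" for x y
      by (rule fun_upd_twist) (use False in auto)
    ultimately have "qtyp \<U> Ps \<Gamma> (\<Delta>((s, p', r') \<mapsto> (l', None) # \<tau>', (s, p, r) \<mapsto> \<tau>)) s
        (chan_upd (chan_upd \<sigma> p' r' ((l', None) # \<sigma> p' r')) p r w)"
      by (simp only: chan_upd_other[OF False] chan_upd_commute[OF False[symmetric]])
    with w(1,2) show ?thesis
      by (intro conjI exI[of _ w]) (simp_all only: chan_upd_other[OF False[symmetric]])
  qed
next
  case (weaken \<Gamma> \<Delta> s \<sigma> q c)
  from fun_cong[OF weaken.prems(1), of c] show ?case by simp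
qed

lemma Delta_of_chan_upd:
  "p \<in> parts A \<Longrightarrow> r \<in> parts A \<Longrightarrow> p \<noteq> r \<Longrightarrow>
    (Delta_of A s \<xi>)((s, p, r) \<mapsto> w) = Delta_of A s (chan_upd \<xi> p r w)"
  by (rule ext) (auto simp: Delta_of_def chan_upd_def split: if_splits)

section \<open>Machines of a universe of CSMs\<close>

lemma csm_universe_same:
  assumes "csm_universe \<U>" "A \<in> \<U>" "p \<in> parts A" "x \<in> states (mach A p)"
    "B \<in> \<U>" "r \<in> parts B" "x \<in> states (mach B r)"
  shows "B = A \<and> r = p"
proof (rule ccontr)
  assume "\<not> (B = A \<and> r = p)"
  then have "(A, p) \<noteq> (B, r)" by blast
  then have "states (mach A p) \<inter> states (mach B r) = {}"
    using assms(1-3,5,6) unfolding csm_universe_def by blast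
  with assms(4,7) show False by blast
qed

lemma csm_universe_wf:
  "csm_universe \<U> \<Longrightarrow> A \<in> \<U> \<Longrightarrow> p \<in> parts A \<Longrightarrow> wf_fsm (alphabet (parts A) p) (mach A p)"
  unfolding csm_universe_def wf_csm_def by blast

lemma owner_unique:
  "csm_universe \<U> \<Longrightarrow> A \<in> \<U> \<Longrightarrow> p \<in> parts A \<Longrightarrow> x \<in> states (mach A p) \<Longrightarrow>
    owner \<U> x p' \<Longrightarrow> p' = p"
  unfolding owner_def using csm_universe_same by metis

text \<open>\<open>delta\<close> collects transitions from all machines of the universe.
  Disjointness of state sets leaves only the machine containing \<open>x\<close>.\<close>

lemma delta_iff:
  assumes "csm_universe \<U>" "A \<in> \<U>" "p \<in> parts A" "x \<in> states (mach A p)"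
  shows "(e, x') \<in> delta \<U> x \<longleftrightarrow> (x, e, x') \<in> trans (mach A p)"
proof
  assume "(e, x') \<in> delta \<U> x"
  then obtain B r where B: "B \<in> \<U>" "r \<in> parts B" "(x, e, x') \<in> trans (mach B r)"
    by (auto simp: delta_def)
  then have "x \<in> states (mach B r)"
    using csm_universe_wf[OF assms(1) B(1,2)] unfolding wf_fsm_def by blast
  then show "(x, e, x') \<in> trans (mach A p)"
    using csm_universe_same[OF assms B(1,2)] B(3) by simp
next
  assume "(x, e, x') \<in> trans (mach A p)"
  then show "(e, x') \<in> delta \<U> x" using assms(2,3) by (auto simp: delta_def)
qed

text \<open>\<open>End\<close> asserts finality in some machine of the universe. Disjointness of
  state sets identifies it with the machine of \<open>p\<close> in \<open>A\<close>, to which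
  sink-finality applies.\<close>

lemma sink_final_End:
  assumes "csm_universe \<U>" "A \<in> \<U>" "p \<in> parts A" "x \<in> states (mach A p)" "sink_final A" "End \<U> x"
  shows "(x, e, x') \<notin> trans (mach A p)"
proof -
  from assms(6) obtain B r where B: "B \<in> \<U>" "r \<in> parts B" "x \<in> finals (mach B r)"
    unfolding End_def by blast
  then have "x \<in> states (mach B r)"
    using csm_universe_wf[OF assms(1) B(1,2)] unfolding wf_fsm_def by blast
  then have "x \<in> finals (mach A p)"
    using csm_universe_same[OF assms(1-4) B(1,2)] B(3) by simp
  then show ?thesis using assms(3-5) unfolding sink_final_def by blast
qed

lemma trans_wf:
  assumes "csm_universe \<U>" "A \<in> \<U>" "p \<in> parts A" "(x, e, x') \<in> trans (mach A p)"
  shows "x' \<in> states (mach A p)"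
    and "e = Some (Snd p' r m) \<Longrightarrow> p' = p \<and> r \<in> parts A \<and> r \<noteq> p"
    and "e = Some (Rcv r p' m) \<Longrightarrow> p' = p \<and> r \<in> parts A \<and> r \<noteq> p"
proof -
  have *: "(x, e, x') \<in> states (mach A p) \<times> ({None} \<union> Some ` alphabet (parts A) p) \<times> states (mach A p)"
    using csm_universe_wf[OF assms(1-3)] assms(4) unfolding wf_fsm_def by blast
  then show "x' \<in> states (mach A p)" by blast
  show "e = Some (Snd p' r m) \<Longrightarrow> p' = p \<and> r \<in> parts A \<and> r \<noteq> p"
    using * by (auto simp: alphabet_def)
  show "e = Some (Rcv r p' m) \<Longrightarrow> p' = p \<and> r \<in> parts A \<and> r \<noteq> p"
    using * by (auto simp: alphabet_def)
qed

section \<open>Invariants of reachable configurations\<close>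

lemma lstep_configs:
  assumes "csm_universe \<U>" "A \<in> \<U>" "lstep A c e c'" "c \<in> configs A"
  shows "c' \<in> configs A"
  using assms(3)
proof cases
  case (snd p q r m q' \<xi>)
  note wf = trans_wf[OF assms(1,2) snd(4,5)]
  from wf(2)[OF HOL.refl] have "r \<in> parts A" "r \<noteq> p" by blast+
  with snd wf(1) assms(4) show ?thesis
    by (auto simp: configs_def chan_upd_def)
next
  case (rcv r q p m q' \<xi> w)
  note wf = trans_wf[OF assms(1,2) rcv(4,5)]
  from wf(3)[OF HOL.refl] have "p \<in> parts A" "r \<noteq> p" by blast+
  with rcv wf(1) assms(4) show ?thesis
    by (auto simp: configs_def chan_upd_def)
next
  case (eps p q q' \<xi>)
  with trans_wf(1)[OF assms(1,2) eps(4,5)] assms(4) show ?thesis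
    by (auto simp: configs_def)
qed

text \<open>Gives the default values of reachable configurations outside the participants, so that
  typing contexts can determine them completely.\<close>

lemma reach_configs:
  assumes "csm_universe \<U>" "A \<in> \<U>" "c \<in> reach A"
  shows "c \<in> configs A"
proof -
  have init: "init_config A \<in> configs A"
    using csm_universe_wf[OF assms(1,2)] by (auto simp: configs_def init_config_def wf_fsm_def)
  have "c0 \<in> configs A \<Longrightarrow> c1 \<in> configs A" if "exec A c0 es c1" for c0 es c1
    using that by (induction rule: exec.induct) (use lstep_configs[OF assms(1,2)] in blast)+
  with init assms(3) show ?thesis unfolding reach_def by blast
qed

lemma reach_lstep: "c \<in> reach A \<Longrightarrow> lstep A c e c' \<Longrightarrow> c' \<in> reach A"
  unfolding reach_def using exec.intros(2) by fast

section \<open>Progress\<close>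

lemma Gamma_of_EP: "p \<in> parts A \<Longrightarrow> Gamma_of A s q (EP s p) = Some (q p)"
  by (simp add: Gamma_of_def)

text \<open>The context records the states of the participants; elsewhere membership in
  \<open>configs\<close> forces both functions to the same default.\<close>

lemma Gamma_of_inject:
  assumes "(q, \<xi>) \<in> configs A" "(q0, \<xi>0) \<in> configs A"
    and "Gamma_of A s q = (Gamma_of A s q0 :: ('x, 's, 'p, 'q) gctx)"
  shows "q = q0"
proof
  fix p show "q p = q0 p"
  proof (cases "p \<in> parts A")
    case True
    from fun_cong[OF assms(3), of "EP s p"] show ?thesis using True by (simp add: Gamma_of_EP)
  next
    case False
    with assms(1,2) show ?thesis by (simp add: configs_def)
  qed
qed

lemma Delta_of_inject:
  assumes "(q, \<xi>) \<in> configs A" "(q0, \<xi>0) \<in> configs A" "Delta_of A s \<xi> = Delta_of A s \<xi>0"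
  shows "\<xi> = \<xi>0"
proof (intro ext)
  fix p r show "\<xi> p r = \<xi>0 p r"
  proof (cases "p \<in> parts A \<and> r \<in> parts A \<and> p \<noteq> r")
    case True
    from fun_cong[OF assms(3), of "(s, p, r)"] show ?thesis using True by (simp add: Delta_of_def)
  next
    case False
    with assms(1,2) show ?thesis by (simp add: configs_def)
  qed
qed

text \<open>By disjointness, \<open>Gamma_of A s q\<close> leaves no binding for the weakening contexts and the queue.\<close>

lemma sf_typ_GammaD:
  fixes R :: "('p, 'l, 'q, 'x, 's, 'i) trm"
  assumes "csm_universe \<U>" "A \<in> \<U>" "(q, \<xi>) \<in> configs A"
    and sf: "sf_typ \<U> \<Theta> A s (Gamma_of A s q) (Delta_of A s \<xi>) R"
  obtains ps Q \<sigma> where "(q, \<xi>) \<in> reach A" "distinct ps" "set ps = parts A" "\<forall>p\<in>parts A. is_proc (Q p)"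
    "scong R (Par (big_par (map Q ps)) (Queue s \<sigma>))"
    "\<forall>p\<in>parts A. ptyp \<U> \<Theta> [EP s p \<mapsto> q p] (Q p)"
    "qtyp \<U> (parts A) (Map.empty :: ('x, 's, 'p, 'q) gctx) (Delta_of A s \<xi>) s \<sigma>"
proof -
  obtain q0 \<xi>0 ps Q \<sigma> and \<Gamma>p :: "'p \<Rightarrow> ('x, 's, 'p, 'q) gctx" and \<Gamma>' where
    \<Delta>: "Delta_of A s \<xi> = Delta_of A s \<xi>0" and reach: "(q0, \<xi>0) \<in> reach A"
    and ps: "distinct ps" "set ps = parts A" "\<forall>p\<in>parts A. is_proc (Q p)"
      "scong R (Par (big_par (map Q ps)) (Queue s \<sigma>))"
    and disj: "ctx_disjoint (parts A) \<Gamma>p"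
      "dom (Gamma_of A s q0 :: ('x, 's, 'p, 'q) gctx) \<inter> dom (ctx_Union (parts A) \<Gamma>p) = {}"
      "dom (Gamma_of A s q0) \<inter> dom \<Gamma>' = {}" "dom (ctx_Union (parts A) \<Gamma>p) \<inter> dom \<Gamma>' = {}"
    and \<Gamma>: "Gamma_of A s q = Gamma_of A s q0 ++ ctx_Union (parts A) \<Gamma>p ++ \<Gamma>'"
    and P_ok: "\<forall>p\<in>parts A. ptyp \<U> \<Theta> ((\<Gamma>p p)(EP s p \<mapsto> q0 p)) (Q p)"
    and \<sigma>: "qtyp \<U> (parts A) \<Gamma>' (Delta_of A s \<xi>) s \<sigma>"
    using sf unfolding sf_typ_def by (elim conjE exE) (rule that)
  \<comment> \<open>The domain does not depend on the states, so the argument also covers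
    \<open>q0\<close>, which is not yet known to equal \<open>q\<close>.\<close>
  have doms: "dom (Gamma_of A s q' :: ('x, 's, 'p, 'q) gctx) = EP s ` parts A" for q'
  proof (rule set_eqI)
    show "c \<in> dom (Gamma_of A s q') \<longleftrightarrow> c \<in> EP s ` parts A" for c :: "('x, 's, 'p) endpoint"
      by (cases c) (auto simp: Gamma_of_def dom_def)
  qed
  have "dom (ctx_Union (parts A) \<Gamma>p) \<subseteq> EP s ` parts A" "dom \<Gamma>' \<subseteq> EP s ` parts A"
    using arg_cong[OF \<Gamma>, of dom] unfolding doms dom_map_add by blast+
  then have "dom (ctx_Union (parts A) \<Gamma>p) = {}" "dom \<Gamma>' = {}"
    using disj(2,3) unfolding doms by blast+
  then have empty: "\<Gamma>' = Map.empty" "ctx_Union (parts A) \<Gamma>p = Map.empty"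
    "\<And>p. p \<in> parts A \<Longrightarrow> \<Gamma>p p = Map.empty"
    using dom_ctx_Union[OF disj(1)] by simp_all
  have eq: "Gamma_of A s q = (Gamma_of A s q0 :: ('x, 's, 'p, 'q) gctx)"
    using \<Gamma> unfolding empty(1,2) map_add_empty .
  \<comment> \<open>The configuration inside the typing judgement is existentially quantified; being
    reachable, it satisfies the defaults that make the contexts injective.\<close>
  note q0 = reach_configs[OF assms(1,2) reach]
  have "q = q0" by (rule Gamma_of_inject[OF assms(3) q0 eq])
  have "\<xi> = \<xi>0" by (rule Delta_of_inject[OF assms(3) q0 \<Delta>])
  show ?thesis
  proof (rule that[OF _ ps])
    show "(q, \<xi>) \<in> reach A" using reach \<open>q = q0\<close> \<open>\<xi> = \<xi>0\<close> by simp
    show "\<forall>p\<in>parts A. ptyp \<U> \<Theta> [EP s p \<mapsto> q p] (Q p)"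
    proof
      fix p assume "p \<in> parts A"
      with P_ok have "ptyp \<U> \<Theta> ((\<Gamma>p p)(EP s p \<mapsto> q0 p)) (Q p)" by blast
      then show "ptyp \<U> \<Theta> [EP s p \<mapsto> q p] (Q p)"
        unfolding empty(3)[OF \<open>p \<in> parts A\<close>] \<open>q = q0\<close> .
    qed
    show "qtyp \<U> (parts A) (Map.empty :: ('x, 's, 'p, 'q) gctx) (Delta_of A s \<xi>) s \<sigma>"
      using \<sigma> unfolding empty(1) .
  qed
qed

lemma sf_typ_GammaI:
  assumes "(q, \<xi>) \<in> reach A" "distinct ps" "set ps = parts A" "\<forall>p\<in>parts A. is_proc (Q p)"
    "R = Par (big_par (map Q ps)) (Queue s \<sigma>)"
    "\<forall>p\<in>parts A. ptyp \<U> \<Theta> [EP s p \<mapsto> q p] (Q p)"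
    "qtyp \<U> (parts A) (Map.empty :: ('x, 's, 'p, 'q) gctx) (Delta_of A s \<xi>) s \<sigma>"
  shows "sf_typ \<U> \<Theta> A s (Gamma_of A s q) (Delta_of A s \<xi>) (R :: ('p, 'l, 'q, 'x, 's, 'i) trm)"
  unfolding sf_typ_def
proof (intro conjI exI)
  let ?\<Gamma>p = "\<lambda>p. Map.empty :: ('x, 's, 'p, 'q) gctx"
  have empty: "ctx_Union (parts A) ?\<Gamma>p = Map.empty" by (rule ctx_Union_empty) simp
  have "\<forall>P\<in>set (map Q ps). is_proc P" using assms(3,4) by simp
  then have "is_rt (big_par (map Q ps))" by (intro is_proc_imp_is_rt is_proc_big_par)
  then show "is_rt R" using assms(5) by simp
  show "ctx_disjoint (parts A) ?\<Gamma>p" by (simp add: ctx_disjoint_def disjoint_family_on_def)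
  show "Gamma_of A s q = Gamma_of A s q ++ ctx_Union (parts A) ?\<Gamma>p ++ Map.empty"
    unfolding empty by simp
  show "dom (Gamma_of A s q) \<inter> dom (ctx_Union (parts A) ?\<Gamma>p) = {}" unfolding empty by simp
  show "dom (Gamma_of A s q :: ('x, 's, 'p, 'q) gctx) \<inter> dom Map.empty = {}" by simp
  show "dom (ctx_Union (parts A) ?\<Gamma>p) \<inter> dom Map.empty = {}" by simp
  show "scong R (Par (big_par (map Q ps)) (Queue s \<sigma>))" unfolding assms(5) by (rule scong_refl)
  show "\<forall>p\<in>parts A. \<forall>c q'. ?\<Gamma>p p c = Some q' \<longrightarrow> End \<U> q'" by simp
  show "Delta_of A s \<xi> = Delta_of A s \<xi>" by (rule HOL.refl)
  show "\<forall>p\<in>parts A. ptyp \<U> \<Theta> ((?\<Gamma>p p)(EP s p \<mapsto> q p)) (Q p)" by (fact assms)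
qed (fact assms)+

text \<open>The part common to sends and receptions: a step of \<open>p\<close> changes only its
  choice, its state and the queues. The remainder \<open>Z\<close> and the other participants keep
  their typings.\<close>

lemma sf_typ_step:
  fixes R :: "('p, 'l, 'q, 'x, 's, 'i) trm"
  assumes reach: "(q, \<xi>) \<in> reach A" and lstep: "lstep A (q, \<xi>) e (q(p := q'), \<xi>')"
    and p: "p \<in> parts A" and ps: "distinct ps" "set ps = parts A"
    and procs: "\<forall>p\<in>parts A. is_proc (Q p)"
    and R: "scong R (Par (big_par (map Q ps)) (Queue s \<sigma>))"
    and Q_ok: "\<forall>p\<in>parts A. ptyp \<U> \<Theta> [EP s p \<mapsto> q p] (Q p)"
    and Qp: "scong (Q p) (Par P0 Z)" "is_proc Z" "ptyp \<U> \<Theta> Map.empty Z"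
    and red: "red D (Par P0 (Queue s \<sigma>)) (Par P' (Queue s \<sigma>'))"
    and P': "is_proc P'" "ptyp \<U> \<Theta> [EP s p \<mapsto> q'] P'"
    and \<sigma>': "qtyp \<U> (parts A) (Map.empty :: ('x, 's, 'p, 'q) gctx) (Delta_of A s \<xi>') s \<sigma>'"
  shows "\<exists>R'. red D R R' \<and> sf_typ \<U> \<Theta> A s (Gamma_of A s (q(p := q'))) (Delta_of A s \<xi>') R'"
proof (intro exI conjI)
  let ?B = "big_par (map Q (remove1 p ps))"
  let ?Q = "Q(p := Par P' Z)"
  have "scong (big_par (map Q ps)) (Par (Q p) ?B)"
    using scong_big_par_remove1 p ps(2) by metis
  also have "scong \<dots> (Par (Par P0 Z) ?B)" by (intro scong_par Qp(1) scong_refl)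
  also have "scong \<dots> (Par P0 (Par Z ?B))" by (rule scong_assoc)
  finally have "scong R (Par (Par P0 (Par Z ?B)) (Queue s \<sigma>))"
    by (rule scong_trans[OF R scong_par[OF _ scong_refl]])
  \<comment> \<open>Communication rules act on a choice standing directly beside the queue.\<close>
  then have "scong R (Par (Par P0 (Queue s \<sigma>)) (Par Z ?B))"
    by (rule scong_trans[OF _ scong_par_swap_tail])
  moreover have "red D (Par (Par P0 (Queue s \<sigma>)) (Par Z ?B)) (Par (Par P' (Queue s \<sigma>')) (Par Z ?B))"
    using red by (rule red_par_left)
  moreover have "scong (Par (Par P' (Queue s \<sigma>')) (Par Z ?B)) (Par (Par (Par P' Z) ?B) (Queue s \<sigma>'))"
    by (rule scong_trans[OF scong_par_swap_tail scong_par[OF scong_sym[OF scong_assoc] scong_refl]])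
  ultimately show "red D R (Par (Par (Par P' Z) ?B) (Queue s \<sigma>'))"
    by (rule red_scong)
  \<comment> \<open>By distinctness \<open>p\<close> no longer occurs in the remaining list, so the
    update at \<open>p\<close> does not affect it.\<close>
  have rest: "map ?Q (remove1 p ps) = map Q (remove1 p ps)"
    using ps(1) by (intro map_cong) auto
  show "sf_typ \<U> \<Theta> A s (Gamma_of A s (q(p := q'))) (Delta_of A s \<xi>')
      (Par (Par (Par P' Z) ?B) (Queue s \<sigma>'))"
  proof (rule sf_typ_GammaI[where ps = "p # remove1 p ps" and Q = ?Q])
    show "(q(p := q'), \<xi>') \<in> reach A" using reach lstep by (rule reach_lstep)
    show "distinct (p # remove1 p ps)" using ps(1) by simp
    show "set (p # remove1 p ps) = parts A" using ps p by auto
    show "\<forall>p'\<in>parts A. is_proc (?Q p')"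
      using procs is_proc.intros(2)[OF P'(1) Qp(2)] by simp
    show "Par (Par (Par P' Z) ?B) (Queue s \<sigma>') = Par (big_par (map ?Q (p # remove1 p ps))) (Queue s \<sigma>')"
      unfolding list.map rest by (simp add: big_par_def)
    have PZ: "ptyp \<U> \<Theta> [EP s p \<mapsto> q'] (Par P' Z)"
      using ptyp.par[OF P'(2) Qp(3)] by simp
    show "\<forall>p'\<in>parts A. ptyp \<U> \<Theta> [EP s p' \<mapsto> (q(p := q')) p'] (?Q p')"
    proof
      fix p' assume "p' \<in> parts A"
      then show "ptyp \<U> \<Theta> [EP s p' \<mapsto> (q(p := q')) p'] (?Q p')"
        using Q_ok PZ by (cases "p' = p") (simp_all only: fun_upd_same fun_upd_other not_False_eq_True)
    qed
  qed (rule \<sigma>')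
qed

theorem theorem5p3:
  fixes \<U> :: "('p, 'l::finite, 'q) csm set"
    and D :: "('p, 'l, 'q, 'x, 's, 'i) defs"
    and \<Theta> :: "'i \<Rightarrow> 'q list"
    and A :: "('p, 'l, 'q) csm"
    and s :: 's
    and q :: "'p \<Rightarrow> 'q"
    and \<xi> :: "'p \<Rightarrow> 'p \<Rightarrow> ('l, 'q) msg list"
    and R :: "('p, 'l, 'q, 'x, 's, 'i) trm"
  assumes "csm_universe \<U>"
    and "wf_defs D"
    and "\<forall>i. set (\<Theta> i) \<subseteq> all_states \<U>"
    and "typable_defs \<U> \<Theta> D"
    and "A \<in> \<U>"
    and "sink_final A"
    and "deadlock_free A"
    and "feasible_eventual_reception A"
    and "(q, \<xi>) \<in> configs A"
    and "sf_typ \<U> \<Theta> A s (Gamma_of A s q) (Delta_of A s \<xi>) R"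
    and "\<exists>q' \<xi>'. cstep A (q, \<xi>) (q', \<xi>')"
  shows "\<exists>R' q' \<xi>'. red D R R' \<and> cstep A (q, \<xi>) (q', \<xi>') \<and>
    sf_typ \<U> \<Theta> A s (Gamma_of A s q') (Delta_of A s \<xi>') R'"
proof -
  note U = assms(1) and A = assms(5)
  obtain ps Q \<sigma> where reach: "(q, \<xi>) \<in> reach A"
    and ps: "distinct ps" "set ps = parts A" and procs: "\<forall>p\<in>parts A. is_proc (Q p)"
    and R: "scong R (Par (big_par (map Q ps)) (Queue s \<sigma>))"
    and Q_ok: "\<forall>p\<in>parts A. ptyp \<U> \<Theta> [EP s p \<mapsto> q p] (Q p)"
    and \<sigma>: "qtyp \<U> (parts A) (Map.empty :: ('x, 's, 'p, 'q) gctx) (Delta_of A s \<xi>) s \<sigma>"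
    using sf_typ_GammaD[OF U A assms(9,10)] by blast
  have q_state: "q p \<in> states (mach A p)" if "p \<in> parts A" for p
    using assms(9) that by (simp add: configs_def)
  note delta = delta_iff[OF U A _ q_state] and own = owner_unique[OF U A _ q_state]
  note step = sf_typ_step[OF reach _ _ ps procs R Q_ok]
  \<comment> \<open>The outgoing transition excludes the \<open>End\<close> alternative by
    sink-finality.\<close>
  have head: "\<exists>P0 Z H. scong (Q p) (Par P0 Z) \<and> is_proc Z \<and> ptyp \<U> \<Theta> Map.empty Z \<and>
      (\<forall>W R'. red D (Par H W) R' \<longrightarrow> red D (Par P0 W) R') \<and>
      is_proc H \<and> ptyp \<U> \<Theta> [EP s p \<mapsto> q p] H \<and> ((\<exists>d bs. H = Send d bs) \<or> (\<exists>d bs. H = Recv d bs))"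
    if "p \<in> parts A" "(q p, e, q') \<in> trans (mach A p)" for p e q'
    using ptyp_singleton_head[OF assms(2,4), of s p "q p" "Q p"] that Q_ok procs
      sink_final_End[OF U A that(1) q_state[OF that(1)] assms(6)] by blast
  \<comment> \<open>Of the given step only its participant, its transition and, for a reception, the
    message at the head of the channel are retained.\<close>
  obtain p e q1 where p: "p \<in> parts A" "(q p, e, q1) \<in> trans (mach A p)"
    and rcv: "\<And>p' r m. e = Some (Rcv p' r m) \<Longrightarrow> \<exists>w. \<xi> p' r = m # w"
    using assms(11) unfolding cstep_def
    by (elim exE lstep.cases) (auto; blast)+
  from head[OF p] obtain P0 Z H where H: "scong (Q p) (Par P0 Z)" "is_proc Z" "ptyp \<U> \<Theta> Map.empty Z"
      "\<And>W R'. red D (Par H W) R' \<Longrightarrow> red D (Par P0 W) R'" "is_proc H"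
      "ptyp \<U> \<Theta> [EP s p \<mapsto> q p] H" "(\<exists>d bs. H = Send d bs) \<or> (\<exists>d bs. H = Recv d bs)"
    by blast
  from H(7) show ?thesis
  proof (elim disjE exE)
    fix d bs assume HS: "H = Send d bs"
    from ptyp_Send_singleton[OF H(6)[unfolded HS]] obtain p' where
      d: "d = EP s p" "bs \<noteq> []" "owner \<U> (q p) p'"
      and bs: "\<forall>(r, l, v, P)\<in>set bs. v = None \<and>
        (\<exists>q'. (Some (Snd p' r (l, None)), q') \<in> delta \<U> (q p) \<and> ptyp \<U> \<Theta> [EP s p \<mapsto> q'] P)"
      by blast
    have p': "p' = p" using own[OF p(1) p(1) d(3)] .
    \<comment> \<open>Any branch would do; the first one is fired. Its transition may differ from
      the given one.\<close>
    obtain r l v P bs' where bs_eq: "bs = (r, l, v, P) # bs'"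
      using d(2) by (cases bs) auto
    with bs p' obtain q' where v: "v = None"
      and q': "(Some (Snd p r (l, None)), q') \<in> delta \<U> (q p)" "ptyp \<U> \<Theta> [EP s p \<mapsto> q'] P"
      by auto
    have tr: "(q p, Some (Snd p r (l, None)), q') \<in> trans (mach A p)"
      using delta[OF p(1) p(1)] q'(1) by blast
    have r: "r \<in> parts A" "p \<noteq> r" using trans_wf(2)[OF U A p(1) tr HOL.refl] by blast+
    let ?\<sigma> = "chan_upd \<sigma> p r (\<sigma> p r @ [(l, None)])"
    let ?\<xi> = "chan_upd \<xi> p r (\<xi> p r @ [(l, None)])"
    have P: "is_proc P" using H(5) unfolding HS bs_eq by (auto elim: is_proc.cases)
    have "red D (Par (Send (EP s p) bs) (Queue s \<sigma>)) (Par (ceil P) (Queue s ?\<sigma>))"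
    proof (rule red.send)
      show "\<forall>(r, l, v, P)\<in>set bs. v \<in> range (map_option val_ep)"
        using bs by (auto intro!: range_eqI[of _ _ None])
      show "0 < length bs" using d(2) by simp
      show "bs ! 0 = (r, l, map_option val_ep None, P)" by (simp add: bs_eq v)
    qed
    then have red: "red D (Par P0 (Queue s \<sigma>)) (Par P (Queue s ?\<sigma>))"
      using H(4) by (simp add: HS d(1) ptyp_ceil[OF q'(2)])
    have lstep: "lstep A (q, \<xi>) (Some (Snd p r (l, None))) (q(p := q'), ?\<xi>)"
      using p(1) tr by (rule lstep.snd)
    have "Delta_of A s \<xi> (s, p, r) = Some (\<xi> p r)"
      using p(1) r by (simp add: Delta_of_def)
    from qtyp_snoc[OF \<sigma> this] have "qtyp \<U> (parts A) (Map.empty :: ('x, 's, 'p, 'q) gctx)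
        (Delta_of A s ?\<xi>) s ?\<sigma>"
      unfolding Delta_of_chan_upd[OF p(1) r] .
    from step[OF lstep p(1) H(1-3) red P q'(2) this] lstep show ?thesis
      unfolding cstep_def by blast
  next
    fix d bs assume HR: "H = Recv d bs"
    from ptyp_Recv_singleton[OF H(6)[unfolded HR]] obtain p' where
      d: "d = EP s p" "owner \<U> (q p) p'"
      and bs: "\<forall>(e, q')\<in>delta \<U> (q p). \<exists>r l t. e = Some (Rcv r p' (l, t)) \<and>
        (t = None \<longrightarrow> (\<exists>P. (r, l, None, P) \<in> set bs \<and> ptyp \<U> \<Theta> [EP s p \<mapsto> q'] P))"
      by blast
    have p': "p' = p" using own[OF p(1) p(1) d(2)] .
    \<comment> \<open>Here the given transition itself must be simulated: the equality in the typing
      rule makes it a reception with a matching branch.\<close>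
    have "(e, q1) \<in> delta \<U> (q p)" using delta[OF p(1) p(1)] p(2) by blast
    from bspec[OF bs[unfolded p'] this] have "\<exists>r l t. e = Some (Rcv r p (l, t)) \<and>
        (t = None \<longrightarrow> (\<exists>P. (r, l, None, P) \<in> set bs \<and> ptyp \<U> \<Theta> [EP s p \<mapsto> q1] P))"
      by (simp only: prod.case)
    then obtain r l t where e: "e = Some (Rcv r p (l, t))"
      and branch: "t = None \<Longrightarrow> \<exists>P. (r, l, None, P) \<in> set bs \<and> ptyp \<U> \<Theta> [EP s p \<mapsto> q1] P"
      by blast
    from rcv[OF e] obtain w where w: "\<xi> r p = (l, t) # w" by blast
    have r: "r \<in> parts A" "r \<noteq> p" using trans_wf(3)[OF U A p e] by blast+
    have "Delta_of A s \<xi> (s, r, p) = Some ((l, t) # w)"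
      using p(1) r w by (simp add: Delta_of_def)
    \<comment> \<open>The queues are typed in the empty context, so the message at the head carries
      no payload and the branch found above applies.\<close>
    from qtyp_pop[OF \<sigma> HOL.refl this] obtain w' where t: "t = None" and w': "\<sigma> r p = (l, None) # w'"
      and \<sigma>': "qtyp \<U> (parts A) (Map.empty :: ('x, 's, 'p, 'q) gctx)
        (Delta_of A s (chan_upd \<xi> r p w)) s (chan_upd \<sigma> r p w')"
      unfolding Delta_of_chan_upd[OF r(1) p(1) r(2)] by blast
    from branch[OF t] obtain P where P: "(r, l, None, P) \<in> set bs" "ptyp \<U> \<Theta> [EP s p \<mapsto> q1] P"
      by blast
    from P(1) obtain k where k: "k < length bs" "bs ! k = (r, l, None, P)"
      by (auto simp: in_set_conv_nth)
    have P_proc: "is_proc P" using H(5) P(1) unfolding HR by (auto elim: is_proc.cases)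
    have "red D (Par (Recv (EP s p) bs) (Queue s \<sigma>)) (Par (ceil P) (Queue s (chan_upd \<sigma> r p w')))"
      using k w' by (rule red.recv_no_payload)
    then have red: "red D (Par P0 (Queue s \<sigma>)) (Par P (Queue s (chan_upd \<sigma> r p w')))"
      using H(4) by (simp add: HR d(1) ptyp_ceil[OF P(2)])
    have lstep: "lstep A (q, \<xi>) e (q(p := q1), chan_upd \<xi> r p w)"
      unfolding e using p(1) p(2)[unfolded e] w by (rule lstep.rcv)
    from step[OF lstep p(1) H(1-3) red P_proc P(2) \<sigma>'] lstep show ?thesis
      unfolding cstep_def by blast
  qed
qed

end
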